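(* Let $d\ge1$, let $I_1,\dots,I_d\subset\mathbb R$ be open intervals (bounded or unbounded), $\mathbf I=I_1\times\dots\times I_d$, let $f\colon\mathbf I\to\mathbb R$ be a function and let $\boldsymbol\alpha=(\alpha_1,\dots,\alpha_d)\in\mathbf I$ be fixed. Then the following conditions are equivalent: (1) $f$ is box-monotone; (2) there exist a pseudo-polynomial $W\colon\mathbf I\to\mathbb R$ of degree $(0,0,\dots,0)$ and Borel measures $\mu_{\mathbf b}$ on $\mathbf I$ $(\mathbf b=(b_1,\dots,b_d)\in\{L,r\}^d)$ such that (i) for all $(x_1,\dots,x_d)\in\mathbf I$, $$f(x_1,\dots,x_d)=W(x_1,\dots,x_d)+\sum_{\mathbf b\in\{L,r\}^d}\int_{\mathbf I}\prod_{j=1}^d\chi_{\alpha_j,x_j}^{b_j}(u_j)\,d\mu_{\mathbf b}(u_1,\dots,u_d),$$ (ii) $\mu_{\mathbf b}(K)<\infty$ for every compact set $K\subset\mathbf I$ and every $\mathbf b\in\{L,r\}^d$, (iii) for each $\mathbf b\in\{L,r\}^d$ and $i=1,\dots,d$, if $b_i=L$, then the marginal measure of $\mu_{\mathbf b}$ corresponding to the $i$th coordinate is a discrete measure. Moreover, for a box-monotone function $f$, the pseudo-polynomial $W$ and the measures $\mu_{\mathbf b}$ in (2) are uniquely determined.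
   Context: Divided differences: for a real function $g$ of one variable and pairwise distinct points, $[x_0;g]=g(x_0)$ and $[x_0,\dots,x_n;g]=\dfrac{[x_1,\dots,x_n;g]-[x_0,\dots,x_{n-1};g]}{x_n-x_0}$ for $n\ge1$. Multiple divided differences: for $f\colon\mathbf I\to\mathbb R$ and pairs $\mathbf x_i=(x_{i0},x_{i1})\in I_i^2$ with $x_{i0}\ne x_{i1}$, $[\mathbf x_1;\dots;\mathbf x_d;f]$ is defined by induction on $d$: for $d=1$ it is $[x_{10},x_{11};f]$; for $d>1$ it is $[x_{d0},x_{d1};g]$, where $g(x)=[\mathbf x_1;\dots;\mathbf x_{d-1};f(\cdot,\dots,\cdot,x)]$ for $x\in I_d$. $f$ is box-monotone (equivalently, box-$(1,\dots,1)$-convex) if $[\mathbf x_1;\dots;\mathbf x_d;f]\ge0$ for all such $\mathbf x_1,\dots,\mathbf x_d$. A pseudo-polynomial of degree $(0,\dots,0)$ is a function of the form $W(x_1,\dots,x_d)=\sum_{i=1}^dA_i(x_1,\dots,x_{i-1},x_{i+1},\dots,x_d)$ with arbitrary functions $A_i\colon\prod_{j\ne i}I_j\to\mathbb R$ (constants if $d=1$). For $x,y\in\mathbb R$: $\chi_{x,y}^L=\mathbf 1_{(-\infty,y)}-\mathbf 1_{(-\infty,x)}$ and $\chi_{x,y}^r=\mathbf 1_{(-\infty,y]}-\mathbf 1_{(-\infty,x]}$. Borel measures are nonnegative. The marginal measure of $\mu$ corresponding to the $i$th coordinate is the image of $\mu$ under $(u_1,\dots,u_d)\mapsto u_i$.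 A measure is discrete if it is concentrated on a countable set. *)

theory Defs
  imports "HOL-Analysis.Analysis"
begin

text \<open>
  A point of \<open>I\<^sub>1 \<times> \<dots> \<times> I\<^sub>d\<close> is an extensional function \<open>x \<in> Pi\<^sub>E {1..d} I\<close>, i.e. \<open>x i \<in> I i\<close>
  for \<open>i \<in> {1..d}\<close> and \<open>x i = undefined\<close> otherwise.  Topological and Borel notions on this set are those induced from the
  product topology of \<open>nat \<Rightarrow> real\<close>; as all coordinates outside \<open>{1..d}\<close> are constant on it,
  they agree with the ones of \<open>\<real>\<^sup>d\<close> (see \<open>sets_borel_PiE\<close> and \<open>subtopology_PiE\<close> below).
\<close>

function divdiff :: "real list \<Rightarrow> (real \<Rightarrow> real) \<Rightarrow> real" where
  "divdiff [] g = 0"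
| "divdiff [x] g = g x"
| "divdiff (x # y # zs) g =
     (divdiff (y # zs) g - divdiff (butlast (x # y # zs)) g) / (last (y # zs) - x)"
  by pat_completeness auto
termination
  by (relation "Wellfounded.measure (\<lambda>(xs, g). length xs)") auto

text \<open>
  \<open>y(Suc d := t)\<close> is the point \<open>(y\<^sub>1, \<dots>, y\<^sub>d, t)\<close>. The recursion is started at dimension \<open>0\<close>, where
  \<open>\<lambda>_. undefined\<close> is the only point of the empty product; for \<open>d = 1\<close> this gives the divided
  difference of the function of one variable (see \<open>mult_divdiff_1\<close>).
\<close>

fun mult_divdiff :: "nat \<Rightarrow> (nat \<Rightarrow> real \<times> real) \<Rightarrow> ((nat \<Rightarrow> real) \<Rightarrow> real) \<Rightarrow> real" where
  "mult_divdiff 0 p f = f (\<lambda>_. undefined)"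
| "mult_divdiff (Suc d) p f =
     divdiff [fst (p (Suc d)), snd (p (Suc d))] (\<lambda>t. mult_divdiff d p (\<lambda>y. f (y(Suc d := t))))"

lemma mult_divdiff_1:
  "mult_divdiff 1 p f = divdiff [fst (p 1), snd (p 1)] (\<lambda>t. f (\<lambda>i\<in>{1..1}. t))"
proof -
  have "(\<lambda>_. undefined)(Suc 0 := t) = (\<lambda>i\<in>{1..1}. t)" for t :: real
    by (auto simp: restrict_def)
  then show ?thesis
    by simp
qed

definition box_monotone :: "nat \<Rightarrow> (nat \<Rightarrow> real set) \<Rightarrow> ((nat \<Rightarrow> real) \<Rightarrow> real) \<Rightarrow> bool" where
  "box_monotone d I f \<longleftrightarrow>
     (\<forall>p. (\<forall>i\<in>{1..d}. fst (p i) \<in> I i \<and> snd (p i) \<in> I i \<and> fst (p i) \<noteq> snd (p i)) \<longrightarrow>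
          mult_divdiff d p f \<ge> 0)"

text \<open>
  The point \<open>(x\<^sub>1, \<dots>, x\<^bsub>i-1\<^esub>, x\<^bsub>i+1\<^esub>, \<dots>, x\<^sub>d)\<close> is the restriction of \<open>x\<close> to \<open>{1..d} - {i}\<close>.
\<close>

definition pseudo_polynomial0 :: "nat \<Rightarrow> (nat \<Rightarrow> real set) \<Rightarrow> ((nat \<Rightarrow> real) \<Rightarrow> real) \<Rightarrow> bool" where
  "pseudo_polynomial0 d I W \<longleftrightarrow>
     (\<exists>A :: nat \<Rightarrow> (nat \<Rightarrow> real) \<Rightarrow> real.
        \<forall>x\<in>Pi\<^sub>E {1..d} I. W x = (\<Sum>i=1..d. A i (restrict x ({1..d} - {i}))))"

text \<open>\<open>R\<close> is the superscript \<open>r\<close> of \<open>\<chi>\<^sup>r\<close>.\<close>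

datatype side = L | R

fun chi :: "side \<Rightarrow> real \<Rightarrow> real \<Rightarrow> real \<Rightarrow> real" where
  "chi L x y u = indicator {..<y} u - indicator {..<x} u"
| "chi R x y u = indicator {..y} u - indicator {..x} u"

definition discrete_measure :: "real measure \<Rightarrow> bool" where
  "discrete_measure M \<longleftrightarrow> (\<exists>C. countable C \<and> (AE x in M. x \<in> C))"

definition marginal :: "nat \<Rightarrow> (nat \<Rightarrow> real) measure \<Rightarrow> real measure" where
  "marginal i M = distr M borel (\<lambda>u. u i)"

definition integral_representation ::
  "nat \<Rightarrow> (nat \<Rightarrow> real set) \<Rightarrow> (nat \<Rightarrow> real) \<Rightarrow> ((nat \<Rightarrow> real) \<Rightarrow> real) \<Rightarrow>
   ((nat \<Rightarrow> real) \<Rightarrow> real) \<Rightarrow> ((nat \<Rightarrow> side) \<Rightarrow> (nat \<Rightarrow> real) measure) \<Rightarrow> bool" where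
  "integral_representation d I \<alpha> f W \<mu> \<longleftrightarrow>
     pseudo_polynomial0 d I W \<and>
     (\<forall>b\<in>{1..d} \<rightarrow>\<^sub>E UNIV. sets (\<mu> b) = sets (restrict_space borel (Pi\<^sub>E {1..d} I))) \<and>
     (\<forall>x\<in>Pi\<^sub>E {1..d} I.
        f x = W x + (\<Sum>b\<in>{1..d} \<rightarrow>\<^sub>E UNIV. \<integral>u. (\<Prod>j=1..d. chi (b j) (\<alpha> j) (x j) (u j)) \<partial>\<mu> b)) \<and>
     (\<forall>b\<in>{1..d} \<rightarrow>\<^sub>E UNIV. \<forall>K. compact K \<and> K \<subseteq> Pi\<^sub>E {1..d} I \<longrightarrow> emeasure (\<mu> b) K < \<infinity>) \<and>
     (\<forall>b\<in>{1..d} \<rightarrow>\<^sub>E UNIV. \<forall>i\<in>{1..d}. b i = L \<longrightarrow> discrete_measure (marginal i (\<mu> b)))"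

lemma subtopology_PiE:
  fixes I :: "nat \<Rightarrow> real set"
  shows "top_of_set (Pi\<^sub>E J I) = product_topology (\<lambda>i. top_of_set (I i)) J"
    (is "?S = ?T")
proof -
  have sp: "topspace ?S = Pi\<^sub>E J I" "topspace ?T = Pi\<^sub>E J I"
    by simp_all
  have "continuous_map ?T euclideanreal (\<lambda>u. u i)" for i
  proof (cases "i \<in> J")
    case True
    then have "continuous_map ?T (top_of_set (I i)) (\<lambda>u. u i)"
      by (rule continuous_map_product_projection)
    then show ?thesis
      by (simp add: continuous_map_in_subtopology)
  next
    case False
    have "u i = undefined" if "u \<in> topspace ?T" for u
      using that False by auto
    moreover have "continuous_map ?T euclideanreal (\<lambda>u. undefined)"
      by simp
    ultimately show ?thesis
      using continuous_map_eq[of ?T euclideanreal "\<lambda>u. undefined" "\<lambda>u. u i"] by metis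
  qed
  then have "continuous_map ?T (product_topology (\<lambda>_. euclideanreal) UNIV) (\<lambda>u. u)"
    by (simp only: continuous_map_componentwise_UNIV) blast
  then have 1: "continuous_map ?T ?S (\<lambda>u. u)"
    unfolding euclidean_product_topology continuous_map_in_subtopology sp by simp
  have "continuous_map ?S (top_of_set (I i)) (\<lambda>u. u i)" if "i \<in> J" for i
    using that by (auto simp: continuous_map_in_subtopology PiE_iff
        intro: continuous_on_subset[OF continuous_on_product_coordinates])
  then have 2: "continuous_map ?S ?T (\<lambda>u. u)"
    unfolding continuous_map_componentwise by (auto simp: PiE_iff)
  have "openin ?S U \<longleftrightarrow> openin ?T U" for U
  proof
    assume U: "openin ?S U"
    then have "U \<subseteq> topspace ?T"
      using openin_subset sp by metis
    then have "{x \<in> topspace ?T. x \<in> U} = U"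
      by auto
    then show "openin ?T U"
      using openin_continuous_map_preimage[OF 1 U] by simp
  next
    assume U: "openin ?T U"
    then have "U \<subseteq> topspace ?S"
      using openin_subset sp by metis
    then have "{x \<in> topspace ?S. x \<in> U} = U"
      by auto
    then show "openin ?S U"
      using openin_continuous_map_preimage[OF 2 U] by simp
  qed
  then show ?thesis
    by (simp add: topology_eq)
qed

lemma sets_borel_PiE:
  fixes I :: "nat \<Rightarrow> real set"
  shows "sets (restrict_space borel (Pi\<^sub>E J I)) = sets (restrict_space (Pi\<^sub>M J (\<lambda>_. borel)) (Pi\<^sub>E J I))"
    (is "sets ?M = sets ?N")
proof -
  have sp: "space ?M = Pi\<^sub>E J I" "space ?N = Pi\<^sub>E J I"
    by (auto simp: space_restrict_space space_PiM)
  have "(\<lambda>u. u i) \<in> borel_measurable ?N" for i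
  proof (cases "i \<in> J")
    case True
    then show ?thesis
      by (intro measurable_restrict_space1) simp
  next
    case False
    have "(\<lambda>u. undefined :: real) \<in> borel_measurable ?N"
      by simp
    moreover have "u i = undefined" if "u \<in> space ?N" for u
      using that False by (auto simp: sp)
    ultimately show ?thesis
      by (subst measurable_cong[where g = "\<lambda>u. undefined"]) auto
  qed
  then have "(\<lambda>u. u) \<in> borel_measurable ?N"
    by (intro measurable_coordinatewise_then_product) auto
  then have 1: "(\<lambda>u. u) \<in> ?N \<rightarrow>\<^sub>M ?M"
    by (intro measurable_restrict_space2) (auto simp: sp)
  have "(\<lambda>u. u i) \<in> borel_measurable ?M" for i
    by (intro measurable_restrict_space1 measurable_product_coordinates)
  then have "(\<lambda>u. u) \<in> ?M \<rightarrow>\<^sub>M Pi\<^sub>M J (\<lambda>_. borel)"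
    by (intro measurable_PiM_single') (auto simp: sp PiE_iff space_PiM)
  then have 2: "(\<lambda>u. u) \<in> ?M \<rightarrow>\<^sub>M ?N"
    by (intro measurable_restrict_space2) (auto simp: sp)
  show ?thesis
  proof (intro subset_antisym subsetI)
    fix A assume A: "A \<in> sets ?M"
    then have "A \<subseteq> Pi\<^sub>E J I"
      using sets.sets_into_space[OF A] by (simp only: sp)
    then have "(\<lambda>u. u) -` A \<inter> space ?N = A"
      unfolding sp by auto
    then show "A \<in> sets ?N"
      using measurable_sets[OF 1 A] by (simp only:)
  next
    fix A assume A: "A \<in> sets ?N"
    then have "A \<subseteq> Pi\<^sub>E J I"
      using sets.sets_into_space[OF A] by (simp only: sp)
    then have "(\<lambda>u. u) -` A \<inter> space ?M = A"
      unfolding sp by auto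
    then show "A \<in> sets ?M"
      using measurable_sets[OF 2 A] by (simp only:)
  qed
qed

end

theory Submission
  imports Defs
begin

text \<open>
  Split every point \<open>u\<close> of the line into a right part \<open>(u, R)\<close>, seen by \<open>\<chi>\<^sup>r\<close>, followed by a left part \<open>(u, L)\<close>,
  seen by \<open>\<chi>\<^sup>L\<close>; then \<open>\<chi>\<^sup>b\<^bsub>x,y\<^esub>(u) = 1[(u, b) below y] - 1[(u, b) below x]\<close> for both values of \<open>b\<close>, and a family
  \<open>(\<mu>\<^sub>b)\<close> is the same as one measure on the \<open>d\<close>-th power of the split line whose left parts lie over a
  countable set.  A representation of \<open>f\<close> says exactly that this measure gives every box between cut points
  \<open>x \<le> y\<close> the mass of the mixed difference of \<open>f\<close>.  Such boxes determine the measure, whence uniqueness.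

  Existence is by induction on \<open>d\<close>.  For \<open>f\<close> clamped to a compact box, the functions \<open>f(\<cdot>, t) - f(\<cdot>, a)\<close>
  yield measures \<open>\<nu>\<^sub>t\<close>, increasing in \<open>t\<close> by uniqueness.  With Radon-Nikodym densities \<open>h\<^sub>t\<close> with respect
  to the largest of them, \<open>\<rho>\<close>, and a countable dense set \<open>Q\<close> containing the discontinuities of the total mass of \<open>\<nu>\<^sub>t\<close>,
  the new coordinate is the threshold \<open>inf {q \<in> Q. \<omega> < h\<^sub>q(u)}\<close> with \<open>(u, \<omega>)\<close> distributed as \<open>\<rho>\<close> times
  Lebesgue measure on \<open>[0, 1)\<close>; it is a left part if the infimum lies in \<open>Q\<close> and is not attained.  The
  measures for an exhaustion of the open box by compact ones are consistent and have a supremum.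
\<close>

text \<open>A monotone function of one variable jumps at \<open>t\<close> in two halves, from
  \<open>f(t-)\<close> to \<open>f(t)\<close> and from \<open>f(t)\<close> to \<open>f(t+)\<close>,
  and no one-sided continuity is assumed. The first half becomes mass at \<open>(t, R)\<close>, the
  second mass at \<open>(t, L)\<close>. There are only countably many jumps, so left parts over a
  countable set suffice; without this restriction diffuse mass could be shared freely between left
  and right parts, and uniqueness would fail.

  The obstacle in the induction is that each density \<open>h_t\<close> is fixed only up to a null
  set depending on \<open>t\<close>, so only countably many of them can be compared pointwise. The
  remaining \<open>t\<close> are reached by squeezing: by monotonicity, growth on any set is at most
  the growth of the total mass, so continuity of this single function controls all sets at once.

  The base point \<open>\<alpha>\<close> disappears from mixed differences, because
  \<open>chi\<close> from \<open>\<alpha>\<close> to \<open>y\<close> minus \<open>chi\<close> from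
  \<open>\<alpha>\<close> to \<open>x\<close> is \<open>chi\<close> from \<open>x\<close> to
  \<open>y\<close>. A representation thus fixes the measures first and \<open>W\<close> afterwards,
  as the remainder.\<close>

section \<open>Mixed differences and pseudo-polynomials\<close>

text \<open>The numerator of \<open>mult_divdiff\<close>. Without the division, cut points may
  coincide and adjacent boxes add up, as required of the mass of a box.\<close>

fun mdiff :: "nat \<Rightarrow> (nat \<Rightarrow> real) \<Rightarrow> (nat \<Rightarrow> real) \<Rightarrow> ((nat \<Rightarrow> real) \<Rightarrow> real) \<Rightarrow> real" where
  "mdiff 0 x y f = f (\<lambda>_. undefined)"
| "mdiff (Suc d) x y f =
     mdiff d x y (\<lambda>v. f (v(Suc d := y (Suc d))) - f (v(Suc d := x (Suc d))))"

lemma mdiff_diff: "mdiff d x y (\<lambda>v. f v - g v) = mdiff d x y f - mdiff d x y g"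
proof (induction d arbitrary: f g)
  case (Suc d)
  show ?case
    by (simp add: Suc.IH)
qed simp

lemma mdiff_scale: "mdiff d x y (\<lambda>v. c * f v) = c * mdiff d x y f"
  by (induction d arbitrary: f) (simp_all add: mdiff_diff right_diff_distrib)

lemma mdiff_0: "mdiff d x y (\<lambda>v. 0) = 0"
  using mdiff_scale[of d x y 0] by simp

lemma mdiff_add: "mdiff d x y (\<lambda>v. f v + g v) = mdiff d x y f + mdiff d x y g"
  using mdiff_diff[of d x y f "\<lambda>v. (-1) * g v"] unfolding mdiff_scale by simp

lemma mdiff_sum:
  "mdiff d x y (\<lambda>v. \<Sum>b\<in>A. f b v) = (\<Sum>b\<in>A. mdiff d x y (f b))"
  by (induction A rule: infinite_finite_induct) (auto simp: mdiff_0 mdiff_add)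

lemma mdiff_Suc:
  "mdiff (Suc d) x y f = mdiff d x y (\<lambda>v. f (v(Suc d := y (Suc d))))
     - mdiff d x y (\<lambda>v. f (v(Suc d := x (Suc d))))"
  by (simp add: mdiff_diff)

lemma atLeastAtMost_1_Suc: "{1..Suc d} = insert (Suc d) {1..d}"
  by auto

lemma PiE_1_Suc_upd:
  assumes "v \<in> Pi\<^sub>E {1..d} I" "t \<in> I (Suc d)"
  shows "v(Suc d := t) \<in> Pi\<^sub>E {1..Suc d} I"
  using assms by (simp only: atLeastAtMost_1_Suc PiE_fun_upd)

lemma mdiff_cong:
  assumes "\<And>j. j \<in> {1..d} \<Longrightarrow> x j = x' j" "\<And>j. j \<in> {1..d} \<Longrightarrow> y j = y' j"
  and "\<And>j. j \<in> {1..d} \<Longrightarrow> x j \<in> I j" "\<And>j. j \<in> {1..d} \<Longrightarrow> y j \<in> I j"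
  and "\<And>v. v \<in> Pi\<^sub>E {1..d} I \<Longrightarrow> f v = g v"
  shows "mdiff d x y f = mdiff d x' y' g"
  using assms
proof (induction d arbitrary: f g)
  case 0
  have "(\<lambda>_. undefined) \<in> Pi\<^sub>E {1..0::nat} I" by simp
  with 0(5) show ?case by simp
next
  case (Suc d)
  have "mdiff d x y (\<lambda>v. f (v(Suc d := t))) = mdiff d x' y' (\<lambda>v. g (v(Suc d := t)))"
    if "t \<in> I (Suc d)" for t
    using Suc.prems that by (intro Suc.IH Suc.prems(5) PiE_1_Suc_upd) auto
  then show ?case
    unfolding mdiff_Suc using Suc.prems by simp
qed

lemma mdiff_cong_pts:
  assumes "\<And>j. j \<in> {1..d} \<Longrightarrow> x j = x' j" "\<And>j. j \<in> {1..d} \<Longrightarrow> y j = y' j"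
  shows "mdiff d x y f = mdiff d x' y' f"
  using assms by (rule mdiff_cong[where I = "\<lambda>_. UNIV"]) auto

lemma mdiff_eq_0:
  assumes "i \<in> {1..d}" "x i = y i"
  shows "mdiff d x y f = 0"
  using assms
proof (induction d arbitrary: f)
  case (Suc d)
  then show ?case
    by (cases "i = Suc d") (auto simp: mdiff_0)
qed auto

lemma mdiff_indep:
  assumes "i \<in> {1..d}" "\<And>v s t. f (v(i := s)) = f (v(i := t))"
  shows "mdiff d x y f = 0"
  using assms
proof (induction d arbitrary: f)
  case (Suc d)
  show ?case
  proof (cases "i = Suc d")
    case True
    then have "(\<lambda>v. f (v(Suc d := y (Suc d))) - f (v(Suc d := x (Suc d)))) = (\<lambda>v. 0)"
      using Suc.prems(2) by (metis right_minus_eq)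
    then show ?thesis
      by (simp only: mdiff.simps mdiff_0)
  next
    case False
    then have "mdiff d x y (\<lambda>v. f (v(Suc d := t))) = 0" for t
      using Suc.prems by (intro Suc.IH) (auto simp: fun_upd_twist[of i "Suc d"] simp del: fun_upd_apply)
    then show ?thesis
      by (simp add: mdiff_Suc del: mdiff.simps)
  qed
qed simp

text \<open>A coordinatewise change of variable only moves the cut points. Applied to clamping, it
  turns a clamped function into the original one with clamped corners.\<close>

lemma mdiff_comp:
  "mdiff d x y (\<lambda>v. f (\<lambda>i\<in>{1..d}. h i (v i))) = mdiff d (\<lambda>i. h i (x i)) (\<lambda>i. h i (y i)) f"
proof (induction d arbitrary: f)
  case 0
  show ?case by (simp add: restrict_def)
next
  case (Suc d)
  have "(\<lambda>i\<in>{1..Suc d}. h i ((v(Suc d := t)) i)) = (\<lambda>i\<in>{1..d}. h i (v i))(Suc d := h (Suc d) t)" for v t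
    by (auto simp: restrict_def fun_eq_iff)
  then show ?case
    unfolding mdiff_Suc
    using Suc.IH[of "\<lambda>v. f (v(Suc d := h (Suc d) (x (Suc d))))"] Suc.IH[of "\<lambda>v. f (v(Suc d := h (Suc d) (y (Suc d))))"]
    by (simp only:)
qed

text \<open>Mixed differences factor over products of functions of single coordinates. This is how
  the integrand of the representation becomes the indicator of a box.\<close>

lemma mdiff_prod:
  "mdiff d x y (\<lambda>v. \<Prod>j=1..d. h j (v j)) = (\<Prod>j=1..d. h j (y j) - h j (x j))"
proof (induction d)
  case (Suc d)
  have "(\<Prod>j=1..Suc d. h j ((v(Suc d := t)) j)) = h (Suc d) t * (\<Prod>j=1..d. h j (v j))" for v t
    by (simp add: mult.commute)
  then show ?case
    unfolding mdiff_Suc by (simp only: mdiff_scale Suc.IH) (simp add: algebra_simps)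
qed simp

lemma
  fixes F :: "(nat \<Rightarrow> real) \<Rightarrow> 'a \<Rightarrow> real"
  assumes "\<And>j. j \<in> {1..d} \<Longrightarrow> x j \<in> I j" "\<And>j. j \<in> {1..d} \<Longrightarrow> y j \<in> I j"
  and "\<And>v. v \<in> Pi\<^sub>E {1..d} I \<Longrightarrow> integrable M (F v)"
  shows mdiff_integrable: "integrable M (\<lambda>u. mdiff d x y (\<lambda>v. F v u))" (is ?A)
    and mdiff_integral: "mdiff d x y (\<lambda>v. \<integral>u. F v u \<partial>M) = (\<integral>u. mdiff d x y (\<lambda>v. F v u) \<partial>M)" (is ?B)
proof -
  have "?A \<and> ?B"
    using assms
  proof (induction d arbitrary: F)
    case 0
    have "(\<lambda>_. undefined) \<in> Pi\<^sub>E {1..0::nat} I" by simp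
    with 0(3) show ?case by simp
  next
    case (Suc d)
    have *: "integrable M (\<lambda>u. mdiff d x y (\<lambda>v. F (v(Suc d := t)) u)) \<and>
      mdiff d x y (\<lambda>v. \<integral>u. F (v(Suc d := t)) u \<partial>M) = (\<integral>u. mdiff d x y (\<lambda>v. F (v(Suc d := t)) u) \<partial>M)"
      if "t \<in> I (Suc d)" for t
      using Suc.prems that by (intro Suc.IH Suc.prems(3) PiE_1_Suc_upd) auto
    have "x (Suc d) \<in> I (Suc d)" "y (Suc d) \<in> I (Suc d)"
      using Suc.prems by auto
    note ** = *[OF this(1)] *[OF this(2)]
    then show ?case
      unfolding mdiff_Suc by (subst Bochner_Integration.integral_diff) auto
  qed
  then show ?A ?B by blast+
qed

text \<open>Swapping the two cut points of a coordinate changes the sign; \<open>c\<close> is the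
  product of these signs and hence the same for all \<open>f\<close>.\<close>

lemma mdiff_sort:
  "\<exists>c. \<forall>f. mdiff d x y f = c * mdiff d (\<lambda>i. min (x i) (y i)) (\<lambda>i. max (x i) (y i)) f"
proof (induction d)
  case 0
  show ?case by (auto intro!: exI[of _ 1])
next
  case (Suc d)
  then obtain c where c: "\<And>f. mdiff d x y f = c * mdiff d (\<lambda>i. min (x i) (y i)) (\<lambda>i. max (x i) (y i)) f"
    by auto
  have "mdiff (Suc d) x y f = (if x (Suc d) \<le> y (Suc d) then c else - c) *
      mdiff (Suc d) (\<lambda>i. min (x i) (y i)) (\<lambda>i. max (x i) (y i)) f" for f
    unfolding mdiff_Suc c by (auto simp: min_def max_def algebra_simps)
  then show ?case by blast
qed

lemma mult_divdiff_sort: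
  "mult_divdiff d p f =
   mult_divdiff d (\<lambda>i. (min (fst (p i)) (snd (p i)), max (fst (p i)) (snd (p i)))) f"
proof (induction d arbitrary: f)
  case (Suc d)
  have "divdiff [x, y] g = divdiff [min x y, max x y] g" for x y g
    by (cases "x = y") (auto simp: min_def max_def field_simps)
  then show ?case
    by (simp only: mult_divdiff.simps fst_conv snd_conv) (simp add: Suc)
qed simp

lemma mult_divdiff_eq_mdiff:
  "mult_divdiff d p f =
   mdiff d (\<lambda>i. fst (p i)) (\<lambda>i. snd (p i)) f / (\<Prod>j=1..d. snd (p j) - fst (p j))"
proof (induction d arbitrary: f)
  case (Suc d)
  show ?case
    by (simp add: mdiff_diff Suc diff_divide_distrib[symmetric])
qed simp

lemma box_monotone_iff_mdiff:
  "box_monotone d I f \<longleftrightarrow>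
   (\<forall>x y. (\<forall>j\<in>{1..d}. x j \<in> I j \<and> y j \<in> I j \<and> x j \<le> y j) \<longrightarrow> 0 \<le> mdiff d x y f)"
proof (intro iffI allI impI)
  fix x y assume f: "box_monotone d I f" and xy: "\<forall>j\<in>{1..d}. x j \<in> I j \<and> y j \<in> I j \<and> x j \<le> y j"
  show "0 \<le> mdiff d x y f"
  proof (cases "\<exists>j\<in>{1..d}. x j = y j")
    case True
    then show ?thesis using mdiff_eq_0 by fastforce
  next
    case False
    with xy have less: "\<forall>j\<in>{1..d}. x j < y j"
      by force
    have "0 \<le> mult_divdiff d (\<lambda>i. (x i, y i)) f"
      using f xy False unfolding box_monotone_def by auto
    moreover have "0 < (\<Prod>j=1..d. y j - x j)"
      using less by (intro prod_pos) auto
    ultimately show ?thesis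
      by (auto simp: mult_divdiff_eq_mdiff zero_le_divide_iff)
  qed
next
  assume *: "\<forall>x y. (\<forall>j\<in>{1..d}. x j \<in> I j \<and> y j \<in> I j \<and> x j \<le> y j) \<longrightarrow> 0 \<le> mdiff d x y f"
  show "box_monotone d I f"
    unfolding box_monotone_def
  proof (intro allI impI)
    fix p assume p: "\<forall>i\<in>{1..d}. fst (p i) \<in> I i \<and> snd (p i) \<in> I i \<and> fst (p i) \<noteq> snd (p i)"
    then have m: "min (fst (p i)) (snd (p i)) \<in> I i \<and> max (fst (p i)) (snd (p i)) \<in> I i" if "i \<in> {1..d}" for i
      using that by (auto simp: min_def max_def)
    show "0 \<le> mult_divdiff d p f"
      by (subst mult_divdiff_sort, subst mult_divdiff_eq_mdiff, intro divide_nonneg_nonneg prod_nonneg *[rule_format])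
        (use m in auto)
  qed
qed

section \<open>Pseudo-polynomials as the kernel of mixed differences\<close>

lemma pseudo_polynomial0_mdiff_eq_0:
  assumes "pseudo_polynomial0 d I W"
    and "\<And>j. j \<in> {1..d} \<Longrightarrow> x j \<in> I j" "\<And>j. j \<in> {1..d} \<Longrightarrow> y j \<in> I j"
  shows "mdiff d x y W = 0"
proof -
  obtain A where A: "\<And>v. v \<in> Pi\<^sub>E {1..d} I \<Longrightarrow> W v = (\<Sum>i=1..d. A i (restrict v ({1..d} - {i})))"
    using assms(1) unfolding pseudo_polynomial0_def by blast
  have "mdiff d x y W = mdiff d x y (\<lambda>v. \<Sum>i=1..d. A i (restrict v ({1..d} - {i})))"
    using assms A by (intro mdiff_cong[where I = I]) auto
  also have "\<dots> = (\<Sum>i=1..d. mdiff d x y (\<lambda>v. A i (restrict v ({1..d} - {i}))))"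
    by (rule mdiff_sum)
  also have "\<dots> = 0"
  proof (intro sum.neutral ballI)
    fix i assume i: "i \<in> {1..d}"
    have "restrict (v(i := s)) ({1..d} - {i}) = restrict (v(i := t)) ({1..d} - {i})"
      for v :: "nat \<Rightarrow> real" and s t
      by (auto simp: restrict_def fun_eq_iff)
    then show "mdiff d x y (\<lambda>v. A i (restrict v ({1..d} - {i}))) = 0"
      using i by (intro mdiff_indep) auto
  qed
  finally show ?thesis .
qed

text \<open>Expanding the mixed difference from \<open>\<alpha>\<close> to \<open>x\<close> gives
  \<open>W x\<close> and terms with at least one coordinate frozen at \<open>\<alpha>\<close>. Each
  of these misses a coordinate of \<open>x\<close>, so together they form a
  pseudo-polynomial.\<close>

lemma pseudo_polynomial0_minus_mdiff:
  "\<exists>A :: nat \<Rightarrow> (nat \<Rightarrow> real) \<Rightarrow> real. \<forall>x\<in>extensional {1..d}.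
     W x - mdiff d \<alpha> x W = (\<Sum>i=1..d. A i (restrict x ({1..d} - {i})))"
proof (induction d arbitrary: W)
  case 0
  show ?case by (auto simp: restrict_def)
next
  case (Suc d)
  then have "\<forall>W. \<exists>A :: nat \<Rightarrow> (nat \<Rightarrow> real) \<Rightarrow> real. \<forall>x\<in>extensional {1..d}.
     W x - mdiff d \<alpha> x W = (\<Sum>i=1..d. A i (restrict x ({1..d} - {i})))"
    by blast
  then obtain A :: "((nat \<Rightarrow> real) \<Rightarrow> real) \<Rightarrow> nat \<Rightarrow> (nat \<Rightarrow> real) \<Rightarrow> real"
    where A: "\<And>W x. x \<in> extensional {1..d} \<Longrightarrow>
      W x - mdiff d \<alpha> x W = (\<Sum>i=1..d. A W i (restrict x ({1..d} - {i})))"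
    by metis
  \<comment> \<open>The summand for the last coordinate is the part frozen at
    \<open>\<alpha> (Suc d)\<close>. The others decompose the slice at the last coordinate of
    \<open>x\<close>, which is still present in \<open>z\<close> when a different coordinate has
    been removed.\<close>
  define A' where "A' i z = (if i = Suc d then mdiff d \<alpha> z (\<lambda>v. W (v(Suc d := \<alpha> (Suc d))))
      else A (\<lambda>v. W (v(Suc d := z (Suc d)))) i (restrict z ({1..d} - {i})))" for i z
  have "W x - mdiff (Suc d) \<alpha> x W = (\<Sum>i=1..Suc d. A' i (restrict x ({1..Suc d} - {i})))"
    if x: "x \<in> extensional {1..Suc d}" for x
  proof -
    let ?W = "\<lambda>v. W (v(Suc d := x (Suc d)))" and ?r = "restrict x {1..d}"
    have "A' i (restrict x ({1..Suc d} - {i})) = A ?W i (restrict ?r ({1..d} - {i}))"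
      if "i \<in> {1..d}" for i
    proof -
      have "restrict (restrict x ({1..Suc d} - {i})) ({1..d} - {i}) = restrict ?r ({1..d} - {i})"
        by (auto simp: restrict_def fun_eq_iff)
      with that show ?thesis by (simp add: A'_def)
    qed
    then have "(\<Sum>i=1..d. A' i (restrict x ({1..Suc d} - {i}))) = ?W ?r - mdiff d \<alpha> ?r ?W"
      by (subst A) auto
    also have "?r(Suc d := x (Suc d)) = x"
      using x by (auto simp: restrict_def extensional_def fun_eq_iff)
    also have "mdiff d \<alpha> ?r ?W = mdiff d \<alpha> x ?W"
      by (rule mdiff_cong_pts) auto
    finally have 1: "(\<Sum>i=1..d. A' i (restrict x ({1..Suc d} - {i}))) = W x - mdiff d \<alpha> x ?W" .
    have 2: "A' (Suc d) (restrict x ({1..Suc d} - {Suc d})) = mdiff d \<alpha> x (\<lambda>v. W (v(Suc d := \<alpha> (Suc d))))"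
      by (auto simp: A'_def intro!: mdiff_cong_pts)
    show ?thesis
      unfolding mdiff_Suc using 1 2 by simp
  qed
  then show ?case by blast
qed

text \<open>For the converse, the mixed difference from \<open>\<alpha>\<close> to \<open>x\<close>
  vanishes, by \<open>mdiff_sort\<close> even if these corners are not ordered, so the preceding
  decomposition has no error term.\<close>

lemma pseudo_polynomial0_iff_mdiff:
  assumes "\<alpha> \<in> Pi\<^sub>E {1..d} I"
  shows "pseudo_polynomial0 d I W \<longleftrightarrow>
    (\<forall>x y. (\<forall>j\<in>{1..d}. x j \<in> I j \<and> y j \<in> I j \<and> x j \<le> y j) \<longrightarrow> mdiff d x y W = 0)"
proof (intro iffI allI impI)
  fix x y assume "pseudo_polynomial0 d I W" "\<forall>j\<in>{1..d}. x j \<in> I j \<and> y j \<in> I j \<and> x j \<le> y j"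
  then show "mdiff d x y W = 0"
    by (intro pseudo_polynomial0_mdiff_eq_0) auto
next
  assume *: "\<forall>x y. (\<forall>j\<in>{1..d}. x j \<in> I j \<and> y j \<in> I j \<and> x j \<le> y j) \<longrightarrow> mdiff d x y W = 0"
  obtain A :: "nat \<Rightarrow> (nat \<Rightarrow> real) \<Rightarrow> real" where A: "\<And>x. x \<in> extensional {1..d} \<Longrightarrow>
     W x - mdiff d \<alpha> x W = (\<Sum>i=1..d. A i (restrict x ({1..d} - {i})))"
    using pseudo_polynomial0_minus_mdiff by blast
  have "W x = (\<Sum>i=1..d. A i (restrict x ({1..d} - {i})))" if x: "x \<in> Pi\<^sub>E {1..d} I" for x
  proof -
    obtain c where c: "mdiff d \<alpha> x W = c * mdiff d (\<lambda>i. min (\<alpha> i) (x i)) (\<lambda>i. max (\<alpha> i) (x i)) W"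
      using mdiff_sort by blast
    have "mdiff d (\<lambda>i. min (\<alpha> i) (x i)) (\<lambda>i. max (\<alpha> i) (x i)) W = 0"
      using x assms by (intro *[rule_format]) (auto simp: min_def max_def)
    with c A[of x] x show ?thesis
      by (simp add: PiE_def)
  qed
  then show "pseudo_polynomial0 d I W"
    unfolding pseudo_polynomial0_def by blast
qed

section \<open>The split line and uniqueness of measures on its powers\<close>

text \<open>The cut at \<open>t\<close> passes between \<open>(t, R)\<close> and
  \<open>(t, L)\<close>: a right part counts when it is at most \<open>t\<close>, as in
  \<open>chi R\<close>, a left part when it is less than \<open>t\<close>, as in
  \<open>chi L\<close>. For \<open>s < t\<close>, \<open>gap s t\<close> thus contains
  \<open>(s, L)\<close> and \<open>(t, R)\<close> but neither \<open>(s, R)\<close> nor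
  \<open>(t, L)\<close>.\<close>

definition below :: "real \<Rightarrow> (real \<times> side) set" where
  "below t = {z. fst z < t \<or> fst z = t \<and> snd z = R}"

definition gap :: "real \<Rightarrow> real \<Rightarrow> (real \<times> side) set" where
  "gap s t = below t - below s"

lemma chi_eq_below: "chi s x y u = indicator (below y) (u, s) - indicator (below x) (u, s)"
  by (cases s) (auto simp: below_def indicator_def)

lemma below_mono: "s \<le> t \<Longrightarrow> below s \<subseteq> below t"
  by (auto simp: below_def)

lemma chi_eq_gap: "x \<le> y \<Longrightarrow> chi s x y u = indicator (gap x y) (u, s)"
  using below_mono[of x y] by (auto simp: chi_eq_below gap_def indicator_def)

lemma gap_eq_empty: "t \<le> s \<Longrightarrow> gap s t = {}"
  using below_mono by (auto simp: gap_def)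

lemma gap_Int: "gap s t \<inter> gap s' t' = gap (max s s') (min t t')"
  by (auto simp: gap_def below_def max_def min_def)

lemma gap_subset: "z \<in> gap s t \<Longrightarrow> s \<le> fst z \<and> fst z \<le> t"
  by (auto simp: gap_def below_def)

lemma less_in_gap: "s < fst z \<Longrightarrow> fst z < t \<Longrightarrow> z \<in> gap s t"
  by (auto simp: gap_def below_def)

definition split_borel :: "(real \<times> side) measure" where
  "split_borel = borel \<Otimes>\<^sub>M count_space UNIV"

definition split_space :: "nat \<Rightarrow> (nat \<Rightarrow> real \<times> side) measure" where
  "split_space d = Pi\<^sub>M {1..d} (\<lambda>_. split_borel)"

definition gapbox :: "nat \<Rightarrow> (nat \<Rightarrow> real) \<Rightarrow> (nat \<Rightarrow> real) \<Rightarrow> (nat \<Rightarrow> real \<times> side) set" where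
  "gapbox d x y = Pi\<^sub>E {1..d} (\<lambda>j. gap (x j) (y j))"

text \<open>Condition (iii) for all coordinates and all \<open>b\<close> at once. One set
  \<open>C\<close> is enough because finite unions of countable sets are countable, and it may be
  enlarged when two measures are compared.\<close>

definition left_parts_in :: "nat \<Rightarrow> real set \<Rightarrow> (nat \<Rightarrow> real \<times> side) measure \<Rightarrow> bool" where
  "left_parts_in d C N \<longleftrightarrow> (AE z in N. \<forall>j\<in>{1..d}. snd (z j) = L \<longrightarrow> fst (z j) \<in> C)"

lemma space_split_borel [simp]: "space split_borel = UNIV"
  by (simp add: split_borel_def space_pair_measure)

lemma space_split_space: "space (split_space d) = Pi\<^sub>E {1..d} (\<lambda>_. UNIV)"
  by (simp add: split_space_def space_PiM)

lemma measurable_fst_split [measurable]: "fst \<in> borel_measurable split_borel"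
  unfolding split_borel_def by simp

lemma measurable_snd_split [measurable]: "snd \<in> split_borel \<rightarrow>\<^sub>M count_space UNIV"
  unfolding split_borel_def by simp

lemma below_sets [measurable]: "below t \<in> sets split_borel"
proof -
  have "{z \<in> space split_borel. fst z < t \<or> fst z = t \<and> snd z = R} \<in> sets split_borel"
    by measurable
  then show ?thesis by (simp add: below_def)
qed

lemma gap_sets [measurable]: "gap s t \<in> sets split_borel"
  unfolding gap_def by measurable

lemma gapbox_sets [measurable]: "gapbox d x y \<in> sets (split_space d)"
  unfolding gapbox_def split_space_def by (intro sets_PiM_I_finite) auto

lemma measurable_coord_split [measurable]: "j \<in> {1..d} \<Longrightarrow> (\<lambda>z. z j) \<in> split_space d \<rightarrow>\<^sub>M split_borel"
  unfolding split_space_def by (rule measurable_component_singleton)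

lemma countable_borel: "countable (C :: real set) \<Longrightarrow> C \<in> sets borel"
  by (rule sets.countable) auto

lemma left_parts_sets:
  assumes "countable C"
  shows "{z \<in> space (split_space d). \<forall>j\<in>{1..d}. snd (z j) = L \<longrightarrow> fst (z j) \<in> C} \<in> sets (split_space d)"
proof (rule sets.sets_Collect_finite_All, goal_cases)
  case (1 j)
  note countable_borel[OF assms, measurable] 1[measurable]
  show ?case by measurable
qed auto

lemma gapbox_Int:
  "gapbox d x y \<inter> gapbox d x' y' = gapbox d (\<lambda>j. max (x j) (x' j)) (\<lambda>j. min (y j) (y' j))"
  unfolding gapbox_def PiE_Int gap_Int by simp

lemma gapbox_mono:
  assumes "\<And>j. j \<in> {1..d} \<Longrightarrow> x' j \<le> x j" "\<And>j. j \<in> {1..d} \<Longrightarrow> y j \<le> y' j"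
  shows "gapbox d x y \<subseteq> gapbox d x' y'"
  unfolding gapbox_def gap_def using assms below_mono by (intro PiE_mono) blast

section \<open>The sigma-algebra seen by the gaps\<close>

definition gap_sigma :: "(real \<times> side) measure" where
  "gap_sigma = sigma UNIV {gap s t | s t. s \<le> t}"

lemma sets_gap_sigma: "sets gap_sigma = sigma_sets UNIV {gap s t | s t. s \<le> t}"
  unfolding gap_sigma_def by simp

lemma space_gap_sigma [simp]: "space gap_sigma = UNIV"
  unfolding gap_sigma_def by simp

lemma gap_in_gap_sigma: "gap s t \<in> sets gap_sigma"
proof (cases "s \<le> t")
  case True
  then show ?thesis unfolding sets_gap_sigma by (intro sigma_sets.Basic) auto
next
  case False
  then have "gap s t = {}" by (intro gap_eq_empty) auto
  then show ?thesis by simp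
qed

lemma below_in_gap_sigma: "below t \<in> sets gap_sigma"
proof -
  have "z \<in> below t \<longleftrightarrow> (\<exists>n::nat. z \<in> gap (t - real n) t)" for z
  proof
    assume z: "z \<in> below t"
    obtain n :: nat where "t - fst z < real n"
      using reals_Archimedean2 by blast
    with z show "\<exists>n::nat. z \<in> gap (t - real n) t"
      by (intro exI[of _ n]) (auto simp: gap_def below_def)
  qed (auto simp: gap_def)
  then have "below t = (\<Union>n::nat. gap (t - real n) t)" by auto
  then show ?thesis using gap_in_gap_sigma by auto
qed

lemma measurable_fst_gap_sigma: "fst \<in> borel_measurable gap_sigma"
proof (rule borel_measurableI_less)
  fix t
  have "fst z < t \<longleftrightarrow> (\<exists>n. z \<in> below (t - inverse (real (Suc n))))" for z :: "real \<times> side"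
  proof
    assume "fst z < t"
    then obtain n where "inverse (real (Suc n)) < t - fst z"
      using reals_Archimedean[of "t - fst z"] by auto
    then show "\<exists>n. z \<in> below (t - inverse (real (Suc n)))"
      by (intro exI[of _ n]) (auto simp: below_def)
  next
    assume "\<exists>n. z \<in> below (t - inverse (real (Suc n)))"
    then obtain n where "z \<in> below (t - inverse (real (Suc n)))" ..
    then have "fst z \<le> t - inverse (real (Suc n))" by (auto simp: below_def)
    moreover have "inverse (real (Suc n)) > 0" by simp
    ultimately show "fst z < t" by linarith
  qed
  then have "{z \<in> space gap_sigma. fst z < t} = (\<Union>n. below (t - inverse (real (Suc n))))"
    by auto
  then show "{z \<in> space gap_sigma. fst z < t} \<in> sets gap_sigma"
    using below_in_gap_sigma by auto
qed

definition fold_left :: "real set \<Rightarrow> real \<times> side \<Rightarrow> real \<times> side" where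
  "fold_left C z = (fst z, if fst z \<in> C then snd z else R)"

lemma measurable_fold_left:
  assumes "countable C"
  shows "fold_left C \<in> gap_sigma \<rightarrow>\<^sub>M split_borel"
proof -
  note measurable_fst_gap_sigma[measurable]
  \<comment> \<open>For each \<open>c\<close> the difference on the right is the single point
    \<open>(c, L)\<close>. Only these points keep the tag \<open>L\<close> under folding, and
    countability of \<open>C\<close> makes their union measurable.\<close>
  have L: "{z. snd (fold_left C z) = L} = (\<Union>c\<in>C. {z \<in> space gap_sigma. fst z \<le> c} - below c)"
    by (auto simp: fold_left_def below_def split: if_splits; metis side.exhaust)
  also have "\<dots> \<in> sets gap_sigma"
  proof (intro sets.countable_UN' assms)
    have "{z \<in> space gap_sigma. fst z \<le> c} \<in> sets gap_sigma" for c
      by measurable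
    then show "(\<lambda>c. {z \<in> space gap_sigma. fst z \<le> c} - below c) ` C \<subseteq> sets gap_sigma"
      using below_in_gap_sigma by auto
  qed
  finally have L': "{z. snd (fold_left C z) = L} \<in> sets gap_sigma" .
  have R': "{z. snd (fold_left C z) = R} = space gap_sigma - {z. snd (fold_left C z) = L}"
    by (auto; metis side.exhaust)
  have "(\<lambda>z. snd (fold_left C z)) \<in> gap_sigma \<rightarrow>\<^sub>M count_space UNIV"
  proof (rule measurable_count_space_eq_countable[THEN iffD2], goal_cases)
    case 1
    have "(UNIV :: side set) \<subseteq> {L, R}" using side.exhaust by auto
    then show ?case using countable_subset by blast
  next
    case 2
    have "(\<lambda>z. snd (fold_left C z)) -` {s} \<inter> space gap_sigma \<in> sets gap_sigma" for s
    proof -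
      have "(\<lambda>z. snd (fold_left C z)) -` {s} \<inter> space gap_sigma = {z. snd (fold_left C z) = s}"
        by auto
      then show ?thesis using L' sets.compl_sets[OF L'] R' by (cases s) simp_all
    qed
    then show ?case by auto
  qed
  moreover have "(\<lambda>z. fst (fold_left C z)) \<in> borel_measurable gap_sigma"
    by (simp add: fold_left_def measurable_fst_gap_sigma)
  ultimately show ?thesis
    unfolding split_borel_def by (intro measurable_pair) (auto simp: comp_def)
qed

text \<open>A product sigma-algebra is generated by boxes of generators provided that countably many
  generators cover each factor; the gaps from \<open>-n\<close> to \<open>n\<close> do.\<close>

lemma sets_gap_PiM:
  "sets (Pi\<^sub>M {1..d} (\<lambda>_. gap_sigma)) =
   sigma_sets (Pi\<^sub>E {1..d} (\<lambda>_. UNIV)) {gapbox d x y | x y. \<forall>j. x j \<le> y j}"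
proof -
  let ?E = "{gap s t | s t. s \<le> t}"
  define P where "P = {{f\<in>(\<Pi>\<^sub>E i\<in>{1..d}. UNIV). \<forall>i\<in>j. f i \<in> A i} | A j. j \<in> {{1..d}} \<and> A \<in> Pi j (\<lambda>_. ?E)}"
  have P: "P = {gapbox d x y | x y. \<forall>j. x j \<le> y j}"
  proof (intro subset_antisym subsetI)
    fix X assume "X \<in> P"
    then obtain A where A: "A \<in> Pi {1..d} (\<lambda>_. ?E)" "X = {f\<in>(\<Pi>\<^sub>E i\<in>{1..d}. UNIV). \<forall>i\<in>{1..d}. f i \<in> A i}"
      unfolding P_def by blast
    have "\<exists>p. A i = gap (fst p) (snd p) \<and> fst p \<le> snd p" if i: "i \<in> {1..d}" for i
    proof -
      obtain s t where "A i = gap s t \<and> s \<le> t"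
        using Pi_mem[OF A(1) i] by blast
      then show ?thesis by (intro exI[of _ "(s, t)"]) simp
    qed
    then obtain p where p: "\<And>i. i \<in> {1..d} \<Longrightarrow> A i = gap (fst (p i)) (snd (p i)) \<and> fst (p i) \<le> snd (p i)"
      by metis
    have "X = gapbox d (\<lambda>i. if i \<in> {1..d} then fst (p i) else 0) (\<lambda>i. if i \<in> {1..d} then snd (p i) else 0)"
      unfolding A(2) gapbox_def using p by (auto simp: PiE_iff extensional_def)
    moreover have "\<forall>j. (if j \<in> {1..d} then fst (p j) else 0) \<le> (if j \<in> {1..d} then snd (p j) else 0)"
      using p by auto
    ultimately show "X \<in> {gapbox d x y | x y. \<forall>j. x j \<le> y j}"
      by blast
  next
    fix X assume "X \<in> {gapbox d x y | x y. \<forall>j. x j \<le> y j}"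
    then obtain x y where xy: "X = gapbox d x y" "\<forall>j. x j \<le> y j" by blast
    have "X = {f\<in>(\<Pi>\<^sub>E i\<in>{1..d}. UNIV). \<forall>i\<in>{1..d}. f i \<in> gap (x i) (y i)}"
      unfolding xy gapbox_def by (auto simp: PiE_iff extensional_def)
    moreover have "(\<lambda>i. gap (x i) (y i)) \<in> Pi {1..d} (\<lambda>_. ?E)"
      using xy by (intro Pi_I) blast
    ultimately show "X \<in> P"
      unfolding P_def by (intro CollectI exI[of _ "\<lambda>i. gap (x i) (y i)"] exI[of _ "{1..d}"] conjI) simp_all
  qed
  have "sets (Pi\<^sub>M {1..d} (\<lambda>_. gap_sigma)) = sets (sigma (\<Pi>\<^sub>E i\<in>{1..d}. UNIV) P)"
    unfolding P_def gap_sigma_def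
  proof (rule sets_PiM_sigma)
    fix i assume "i \<in> {1..d}"
    have "z \<in> (\<Union>n::nat. gap (- real n) (real n))" for z
    proof -
      obtain n :: nat where "\<bar>fst z\<bar> < real n" using reals_Archimedean2 by blast
      then show ?thesis by (intro UN_I[of n] less_in_gap) auto
    qed
    then have "UNIV = \<Union>(range (\<lambda>n::nat. gap (- real n) (real n)))" by blast
    moreover have "range (\<lambda>n::nat. gap (- real n) (real n)) \<subseteq> ?E"
    proof
      fix X assume "X \<in> range (\<lambda>n::nat. gap (- real n) (real n))"
      then obtain n :: nat where "X = gap (- real n) (real n)" by blast
      then show "X \<in> ?E" by (intro CollectI exI[of _ "- real n"] exI[of _ "real n"]) simp
    qed
    ultimately show "\<exists>S\<subseteq>?E. countable S \<and> UNIV = \<Union>S"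
      by (intro exI[of _ "range (\<lambda>n::nat. gap (- real n) (real n))"]) auto
  qed auto
  also have "\<dots> = sigma_sets (\<Pi>\<^sub>E i\<in>{1..d}. UNIV) P"
    by (rule sets_measure_of) (auto simp: P_def)
  finally show ?thesis unfolding P .
qed

text \<open>The gap boxes generate too small a \<open>\<sigma>\<close>-algebra: it does not separate \<open>(u, L)\<close> from \<open>(u, R)\<close> for
  uncountably many \<open>u\<close> at once.  As left parts lie over a countable set, folding the others onto right
  parts changes nothing almost everywhere and is measurable with respect to this smaller \<open>\<sigma>\<close>-algebra.\<close>

lemma split_measure_eqI:
  assumes sN: "sets N = sets (split_space d)" and sN': "sets N' = sets (split_space d)"
    and C: "countable C" "left_parts_in d C N" "left_parts_in d C N'"
    and eq: "\<And>x y. (\<And>j. x j \<le> y j) \<Longrightarrow> emeasure N (gapbox d x y) = emeasure N' (gapbox d x y)"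
    and fin: "\<And>x y. (\<And>j. x j \<le> y j) \<Longrightarrow> emeasure N (gapbox d x y) \<noteq> \<infinity>"
  shows "N = N'"
proof -
  let ?Z0 = "Pi\<^sub>M {1..d} (\<lambda>_. gap_sigma)"
  let ?\<Omega> = "Pi\<^sub>E {1..d} (\<lambda>_. UNIV :: (real \<times> side) set)"
  define \<pi> where "\<pi> z = (\<lambda>j\<in>{1..d}. fold_left C (z j))" for z
  have spN: "space N = ?\<Omega>" "space N' = ?\<Omega>"
    using sN sN' space_split_space by (metis sets_eq_imp_space_eq)+
  have box0: "gapbox d x y \<in> sets ?Z0" for x y
    unfolding gapbox_def by (intro sets_PiM_I_finite gap_in_gap_sigma) auto
  have id: "(\<lambda>z. z) \<in> N \<rightarrow>\<^sub>M ?Z0" "(\<lambda>z. z) \<in> N' \<rightarrow>\<^sub>M ?Z0"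
  proof -
    have "(\<lambda>z. z) \<in> split_space d \<rightarrow>\<^sub>M ?Z0"
    proof (rule measurable_sigma_sets[OF sets_gap_PiM])
      show "{gapbox d x y | x y. \<forall>j. x j \<le> y j} \<subseteq> Pow ?\<Omega>"
        by (auto simp: gapbox_def PiE_iff)
      show "(\<lambda>z. z) \<in> space (split_space d) \<rightarrow> ?\<Omega>"
        by (simp add: space_split_space)
      fix X assume "X \<in> {gapbox d x y | x y. \<forall>j. x j \<le> y j}"
      then obtain x y where X: "X = gapbox d x y" by blast
      have "gapbox d x y \<inter> space (split_space d) \<in> sets (split_space d)"
        by (intro sets.Int gapbox_sets sets.top)
      then show "(\<lambda>z. z) -` X \<inter> space (split_space d) \<in> sets (split_space d)"
        unfolding X by simp
    qed
    then show "(\<lambda>z. z) \<in> N \<rightarrow>\<^sub>M ?Z0" "(\<lambda>z. z) \<in> N' \<rightarrow>\<^sub>M ?Z0"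
      using measurable_cong_sets[OF sN refl] measurable_cong_sets[OF sN' refl] by blast+
  qed
  have \<pi>: "\<pi> \<in> ?Z0 \<rightarrow>\<^sub>M split_space d"
    unfolding split_space_def \<pi>_def
    by (intro measurable_restrict measurable_compose[OF _ measurable_fold_left[OF C(1)]]
        measurable_component_singleton)
  \<comment> \<open>On the smaller sigma-algebra the measures agree because the gap boxes form an
    intersection-stable generator. Pushing forward along \<open>\<pi>\<close>, almost everywhere the
    identity, then returns the measures on the full one.\<close>
  have "distr N ?Z0 (\<lambda>z. z) = distr N' ?Z0 (\<lambda>z. z)"
  proof (rule measure_eqI_generator_eq)
    show "Int_stable {gapbox d x y | x y. \<forall>j. x j \<le> y j}"
    proof (rule Int_stableI)
      fix a b assume "a \<in> {gapbox d x y | x y. \<forall>j. x j \<le> y j}" "b \<in> {gapbox d x y | x y. \<forall>j. x j \<le> y j}"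
      then obtain x y x' y' where "a = gapbox d x y" "b = gapbox d x' y'"
        by blast
      then have ab: "a \<inter> b = gapbox d (\<lambda>j. max (x j) (x' j)) (\<lambda>j. min (y j) (y' j))"
        by (simp add: gapbox_Int)
      \<comment> \<open>The intersection of two boxes may have cut points in the wrong order.
        Raising the upper one leaves the empty gap unchanged and stays inside the generator.\<close>
      have "gap s t = gap s (max s t)" for s t
        by (cases "s \<le> t") (auto simp: max_def gap_eq_empty)
      then have "a \<inter> b = gapbox d (\<lambda>j. max (x j) (x' j)) (\<lambda>j. max (max (x j) (x' j)) (min (y j) (y' j)))"
        unfolding ab gapbox_def by simp
      then show "a \<inter> b \<in> {gapbox d x y | x y. \<forall>j. x j \<le> y j}"
        by (intro CollectI exI) auto
    qed
    show "{gapbox d x y | x y. \<forall>j. x j \<le> y j} \<subseteq> Pow ?\<Omega>"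
      by (auto simp: gapbox_def PiE_iff)
    show "sets (distr N ?Z0 (\<lambda>z. z)) = sigma_sets ?\<Omega> {gapbox d x y | x y. \<forall>j. x j \<le> y j}"
      "sets (distr N' ?Z0 (\<lambda>z. z)) = sigma_sets ?\<Omega> {gapbox d x y | x y. \<forall>j. x j \<le> y j}"
      using sets_gap_PiM by simp_all
    have em: "emeasure (distr N ?Z0 (\<lambda>z. z)) (gapbox d x y) = emeasure N (gapbox d x y)"
      "emeasure (distr N' ?Z0 (\<lambda>z. z)) (gapbox d x y) = emeasure N' (gapbox d x y)" for x y
      using id box0[of x y] spN by (auto simp: emeasure_distr gapbox_def intro!: arg_cong2[where f = emeasure])
    show "emeasure (distr N ?Z0 (\<lambda>z. z)) X = emeasure (distr N' ?Z0 (\<lambda>z. z)) X"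
      if "X \<in> {gapbox d x y | x y. \<forall>j. x j \<le> y j}" for X
      using that em eq by auto
    let ?A = "\<lambda>n::nat. gapbox d (\<lambda>_. - real n) (\<lambda>_. real n)"
    show "range ?A \<subseteq> {gapbox d x y | x y. \<forall>j. x j \<le> y j}"
      by force
    show "emeasure (distr N ?Z0 (\<lambda>z. z)) (?A n) \<noteq> \<infinity>" for n
      unfolding em by (rule fin) simp
    show "(\<Union>n. ?A n) = ?\<Omega>"
    proof (intro subset_antisym subsetI)
      fix z assume z: "z \<in> ?\<Omega>"
      obtain n :: nat where n: "(\<Sum>j\<in>{1..d}. \<bar>fst (z j)\<bar>) < real n" using reals_Archimedean2 by blast
      have "z j \<in> gap (- real n) (real n)" if "j \<in> {1..d}" for j
      proof -
        have "\<bar>fst (z j)\<bar> \<le> (\<Sum>j\<in>{1..d}. \<bar>fst (z j)\<bar>)"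
          by (rule member_le_sum[OF that]) auto
        with n show ?thesis by (intro less_in_gap) auto
      qed
      with z show "z \<in> (\<Union>n. ?A n)" by (intro UN_I[of n]) (auto simp: gapbox_def PiE_iff)
    qed (auto simp: gapbox_def PiE_iff)
  qed
  then have "distr (distr N ?Z0 (\<lambda>z. z)) (split_space d) \<pi> = distr (distr N' ?Z0 (\<lambda>z. z)) (split_space d) \<pi>"
    by simp
  then have eq\<pi>: "distr N (split_space d) \<pi> = distr N' (split_space d) \<pi>"
    by (simp only: distr_distr[OF \<pi> id(1)] distr_distr[OF \<pi> id(2)] comp_def)
  have "distr M (split_space d) \<pi> = M"
    if sM: "sets M = sets (split_space d)" and M: "left_parts_in d C M" "(\<lambda>z. z) \<in> M \<rightarrow>\<^sub>M ?Z0" for M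
  proof -
    have spM: "space M = ?\<Omega>" using sM space_split_space by (metis sets_eq_imp_space_eq)
    have "AE z in M. \<pi> z = z"
      using M(1) AE_space unfolding left_parts_in_def
    proof eventually_elim
      case (elim z)
      show ?case
      proof
        fix j
        show "\<pi> z j = z j"
        proof (cases "j \<in> {1..d}")
          case True
          then have "snd (z j) = L \<longrightarrow> fst (z j) \<in> C" using elim by blast
          then show ?thesis using True
            by (cases "snd (z j)") (auto simp: \<pi>_def fold_left_def prod_eq_iff)
        qed (use elim spM in \<open>auto simp: \<pi>_def\<close>)
      qed
    qed
    then have "distr M (split_space d) \<pi> = distr M (split_space d) (\<lambda>z. z)"
      using measurable_compose[OF M(2) \<pi>] sM
      by (intro distr_cong_AE) (auto intro: measurable_ident_sets)
    also have "\<dots> = M" using sM by (intro distr_id2) simp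
    finally show ?thesis .
  qed
  then have *: "distr N (split_space d) \<pi> = N" "distr N' (split_space d) \<pi> = N'"
    using sN sN' C id by blast+
  show ?thesis
    using eq\<pi> unfolding * .
qed

section \<open>Increasing families of measures\<close>

text \<open>Integrating over the set where \<open>f\<close> exceeds \<open>g\<close> shows that the
  excess has integral zero; finiteness of the integral of \<open>g\<close> permits the subtraction.
  Inequalities between measures thereby become inequalities between densities.\<close>

lemma AE_le_of_nn_integral_le:
  fixes f g :: "'a \<Rightarrow> ennreal"
  assumes [measurable]: "f \<in> borel_measurable M" "g \<in> borel_measurable M"
    and le: "\<And>A. A \<in> sets M \<Longrightarrow> (\<integral>\<^sup>+x. f x * indicator A x \<partial>M) \<le> (\<integral>\<^sup>+x. g x * indicator A x \<partial>M)"
    and fin: "(\<integral>\<^sup>+x. g x \<partial>M) \<noteq> \<infinity>"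
  shows "AE x in M. f x \<le> g x"
proof -
  define B where "B = {x \<in> space M. g x < f x}"
  have B [measurable]: "B \<in> sets M" unfolding B_def by measurable
  have "(\<integral>\<^sup>+x. g x * indicator B x \<partial>M) \<le> (\<integral>\<^sup>+x. g x \<partial>M)"
    by (intro nn_integral_mono) (auto simp: indicator_def)
  then have finB: "(\<integral>\<^sup>+x. g x * indicator B x \<partial>M) \<noteq> \<infinity>"
    using fin by (auto simp: top_unique)
  have "(\<integral>\<^sup>+x. f x * indicator B x - g x * indicator B x \<partial>M) =
      (\<integral>\<^sup>+x. f x * indicator B x \<partial>M) - (\<integral>\<^sup>+x. g x * indicator B x \<partial>M)"
    using finB by (intro nn_integral_diff) (auto simp: B_def indicator_def)
  also have "\<dots> = 0"
    using finB by (intro diff_eq_0_ennreal le_less_trans[OF le[OF B]] le[OF B]) (simp_all add: less_top)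
  finally have "AE x in M. f x * indicator B x - g x * indicator B x = 0"
    by (subst (asm) nn_integral_0_iff_AE) auto
  then show ?thesis
    using AE_space
  proof eventually_elim
    case (elim x)
    show ?case
    proof (rule ccontr)
      assume "\<not> f x \<le> g x"
      with elim have "f x - g x = 0" by (auto simp: B_def not_le)
      with \<open>\<not> f x \<le> g x\<close> show False
        by (metis diff_gr0_ennreal ennreal_zero_less_top less_irrefl not_le order.strict_trans2 top_greatest)
    qed
  qed
qed

text \<open>Turns \<open>\<nu>\<close> into a distribution function in a new coordinate: the part of
  \<open>P\<close> below the cut at \<open>t\<close> projects to \<open>\<nu> t\<close>. The mass of
  \<open>\<nu> a\<close> is placed at \<open>(a, R)\<close>, and a jump from \<open>\<nu> t\<close>
  to the right limit at \<open>t\<close> is placed at \<open>(t, L)\<close>.\<close>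

lemma increasing_measures_lift:
  fixes \<nu> :: "real \<Rightarrow> 'a measure"
  assumes ab: "a \<le> b"
    and sets_\<nu>: "\<And>t. t \<in> {a..b} \<Longrightarrow> sets (\<nu> t) = sets (\<nu> b)"
    and mono_\<nu>: "\<And>s t A. a \<le> s \<Longrightarrow> s \<le> t \<Longrightarrow> t \<le> b \<Longrightarrow> A \<in> sets (\<nu> b) \<Longrightarrow>
        emeasure (\<nu> s) A \<le> emeasure (\<nu> t) A"
    and fin: "finite_measure (\<nu> b)"
  obtains P Q where "sets P = sets (\<nu> b \<Otimes>\<^sub>M split_borel)" "finite_measure P" "countable Q"
    "AE z in P. snd (snd z) = L \<longrightarrow> fst (snd z) \<in> Q"
    "\<And>A. A \<in> sets (\<nu> b) \<Longrightarrow> emeasure P (A \<times> UNIV) = emeasure (\<nu> b) A"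
    "\<And>A t. A \<in> sets (\<nu> b) \<Longrightarrow> emeasure P (A \<times> below t) =
        (if t < a then 0 else if t \<le> b then emeasure (\<nu> t) A else emeasure (\<nu> b) A)"
proof -
  define \<rho> where "\<rho> = \<nu> b"
  \<comment> \<open>A uniform \<open>\<omega>\<close> is less than \<open>h t u\<close> with
    probability \<open>h t u\<close>, since the densities with respect to \<open>\<rho>\<close> are
    at most one almost everywhere.\<close>
  define U where "U = restrict_space lborel {0..<1::real}"
  interpret \<rho>: finite_measure \<rho> using fin by (simp add: \<rho>_def)
  have space_U: "space U = {0..<1}"
    by (simp add: U_def space_restrict_space)
  have em_U: "emeasure U {\<omega>\<in>{0..<1}. ennreal \<omega> < c} = c" if "c \<le> 1" for c
  proof (cases c)
    case (real r)
    with that have r: "0 \<le> r" "r \<le> 1" by auto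
    have "{\<omega>\<in>{0..<1}. ennreal \<omega> < c} = {0..<r}"
      using r real by (auto simp: ennreal_less_iff)
    then show ?thesis
      using r real by (simp add: U_def emeasure_restrict_space)
  qed (use that in \<open>auto simp: top_unique\<close>)
  have em_U1: "emeasure U (space U) = 1"
    by (simp add: space_U U_def emeasure_restrict_space)
  interpret U: finite_measure U
    by (rule finite_measureI) (simp add: em_U1)
  have id_U [measurable]: "(\<lambda>\<omega>. \<omega>) \<in> borel_measurable U"
    unfolding U_def by (intro measurable_restrict_space1) simp

  have fin_\<nu>: "finite_measure (\<nu> t)" if "t \<in> {a..b}" for t
  proof (rule finite_measureI)
    have "emeasure (\<nu> t) (space (\<nu> t)) \<le> emeasure \<rho> (space \<rho>)"
      using mono_\<nu>[of t b "space (\<nu> t)"] that sets_\<nu>[OF that] sets_eq_imp_space_eq[OF sets_\<nu>[OF that]]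
      by (auto simp: \<rho>_def)
    then show "emeasure (\<nu> t) (space (\<nu> t)) \<noteq> \<infinity>"
      using \<rho>.emeasure_finite[of "space \<rho>"] by (auto simp: top_unique)
  qed

  have "\<exists>h\<in>borel_measurable \<rho>. density \<rho> h = \<nu> t" if "t \<in> {a..b}" for t
  proof (rule \<rho>.Radon_Nikodym)
    show "sets (\<nu> t) = sets \<rho>" using sets_\<nu>[OF that] by (simp add: \<rho>_def)
    show "absolutely_continuous \<rho> (\<nu> t)"
      unfolding absolutely_continuous_def
    proof
      fix A assume A: "A \<in> null_sets \<rho>"
      then have "emeasure (\<nu> t) A \<le> emeasure \<rho> A"
        using mono_\<nu>[of t b A] that by (auto simp: \<rho>_def)
      then show "A \<in> null_sets (\<nu> t)"
        using A sets_\<nu>[OF that] by (auto simp: \<rho>_def null_sets_def)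
    qed
  qed
  then obtain h where h [measurable]: "\<And>t. t \<in> {a..b} \<Longrightarrow> h t \<in> borel_measurable \<rho>"
    and dens: "\<And>t. t \<in> {a..b} \<Longrightarrow> density \<rho> (h t) = \<nu> t"
    by metis
  have em_h: "(\<integral>\<^sup>+x. h t x * indicator A x \<partial>\<rho>) = emeasure (\<nu> t) A"
    if "t \<in> {a..b}" "A \<in> sets \<rho>" for t A
    using that by (simp add: dens[symmetric] emeasure_density)
  have int_h: "(\<integral>\<^sup>+x. h t x \<partial>\<rho>) \<noteq> \<infinity>" if "t \<in> {a..b}" for t
  proof -
    have "(\<integral>\<^sup>+x. h t x \<partial>\<rho>) = emeasure (\<nu> t) (space \<rho>)"
      using em_h[OF that sets.top] by (simp cong: nn_integral_cong)
    then show ?thesis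
      using finite_measure.emeasure_finite[OF fin_\<nu>[OF that]] by simp
  qed
  have mono_\<rho>: "emeasure (\<nu> s) A \<le> emeasure (\<nu> t) A"
    if "a \<le> s" "s \<le> t" "t \<le> b" "A \<in> sets \<rho>" for s t A
    using mono_\<nu> that by (simp add: \<rho>_def)
  have \<nu>_b: "emeasure (\<nu> b) A = emeasure \<rho> A" for A
    by (simp add: \<rho>_def)
  have h_mono: "AE x in \<rho>. h s x \<le> h t x" if "a \<le> s" "s \<le> t" "t \<le> b" for s t
    using that int_h[of t] h[of s] h[of t] mono_\<rho>[OF that]
    by (intro AE_le_of_nn_integral_le) (simp_all add: em_h)
  have h_le_1: "AE x in \<rho>. h t x \<le> 1" if "t \<in> {a..b}" for t
    using that h[of t] mono_\<rho>[of t b] \<rho>.emeasure_finite[of "space \<rho>"]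
    by (intro AE_le_of_nn_integral_le) (simp_all add: em_h \<nu>_b)
  have h_b: "AE x in \<rho>. 1 \<le> h b x"
    using ab int_h[of b] h[of b]
    by (intro AE_le_of_nn_integral_le) (simp_all add: em_h \<nu>_b)

  \<comment> \<open>The total mass, continued by constants outside \<open>[a, b]\<close> so that it
    is monotone on the whole line and has countably many discontinuities.\<close>
  define m where "m t = measure (\<nu> (max a (min b t))) (space \<rho>)" for t
  have cl: "max a (min b t) \<in> {a..b}" for t
    using ab by auto
  have measure_mono: "measure (\<nu> s) A \<le> measure (\<nu> t) A"
    if "a \<le> s" "s \<le> t" "t \<le> b" "A \<in> sets \<rho>" for s t A
    using mono_\<nu>[of s t A] that finite_measure.emeasure_finite[OF fin_\<nu>]
    unfolding measure_def by (intro enn2real_mono) (auto simp: \<rho>_def less_top[symmetric])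
  have "mono m"
    unfolding m_def using ab by (intro monoI measure_mono) (auto simp: max_def min_def)
  then have disc: "countable {t. \<not> isCont m t}"
    by (rule mono_ctble_discont)
  \<comment> \<open>Monotonicity on the complement of \<open>A\<close> bounds the growth on
    \<open>A\<close> by the growth of the total mass.\<close>
  have measure_diff_le: "measure (\<nu> t) A - measure (\<nu> s) A \<le> m t - m s"
    if "a \<le> s" "s \<le> t" "t \<le> b" "A \<in> sets \<rho>" for s t A
  proof -
    have "measure (\<nu> r) (space \<rho> - A) = measure (\<nu> r) (space \<rho>) - measure (\<nu> r) A" if "r \<in> {a..b}" for r
      using finite_measure.finite_measure_compl[OF fin_\<nu>[OF that], of A] sets_\<nu>[OF that]
        sets_eq_imp_space_eq[OF sets_\<nu>[OF that]] \<open>A \<in> sets \<rho>\<close> by (simp add: \<rho>_def)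
    then show ?thesis
      using measure_mono[of s t "space \<rho> - A"] that by (auto simp: m_def)
  qed

  \<comment> \<open>Rationals give density, jump points need exact treatment, and with both end
    points included only interior continuity points of \<open>m\<close> remain outside
    \<open>Q\<close>.\<close>
  define Q where "Q = {a, b} \<union> {a..b} \<inter> (\<rat> \<union> {t. \<not> isCont m t})"
  have cQ: "countable Q" unfolding Q_def using disc countable_rat by auto
  have Q_ab: "Q \<subseteq> {a..b}" and Q_ne: "Q \<noteq> {}" and bQ: "b \<in> Q" unfolding Q_def using ab by auto
  have h_Q [measurable]: "q \<in> Q \<Longrightarrow> h q \<in> borel_measurable \<rho>" for q
    using Q_ab by auto

  \<comment> \<open>A threshold that \<open>\<omega>\<close> does not meet is replaced by
    \<open>b\<close>, which keeps the infimum within \<open>[a, b]\<close> and gives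
    \<open>T z = b\<close> if no threshold below \<open>b\<close> is met.\<close>
  define \<phi> where "\<phi> q z = (if ennreal (snd z) < h q (fst z) then q else b)" for q z
  define T where "T z = (INF q\<in>Q. \<phi> q z)" for z
  \<comment> \<open>If \<open>T z\<close> lies in \<open>Q\<close> without being attained,
    \<open>\<omega>\<close> can only be met by thresholds strictly beyond \<open>T z\<close>. The
    new point must then lie after the cut at \<open>T z\<close>, so it is a left part.\<close>
  define E where "E z \<longleftrightarrow> (\<exists>q\<in>Q. T z = q \<and> \<not> ennreal (snd z) < h q (fst z))" for z
  define \<zeta> where "\<zeta> z = (fst z, T z, if E z then L else R)" for z
  define P0 where "P0 = \<rho> \<Otimes>\<^sub>M U"
  define P where "P = distr P0 (\<rho> \<Otimes>\<^sub>M split_borel) \<zeta>"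
  have space_P0: "space P0 = space \<rho> \<times> {0..<1}"
    by (simp add: P0_def space_pair_measure space_U)
  have [measurable]: "fst \<in> P0 \<rightarrow>\<^sub>M \<rho>" "snd \<in> borel_measurable P0"
    unfolding P0_def by simp_all
  have hp [measurable]: "Measurable.pred P0 (\<lambda>z. ennreal (snd z) < h q (fst z))" if "q \<in> Q" for q
  proof -
    note h_Q[OF that, measurable]
    show ?thesis by measurable
  qed
  have \<phi>_meas: "\<phi> q \<in> borel_measurable P0" if "q \<in> Q" for q
  proof -
    note hp[OF that, measurable]
    show ?thesis unfolding \<phi>_def by measurable
  qed
  have T_meas [measurable]: "T \<in> borel_measurable P0"
    unfolding T_def using cQ \<phi>_meas by (rule borel_measurable_cINF_real)
  have E_meas [measurable]: "Measurable.pred P0 E"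
  proof -
    have "{z \<in> space P0. T z = q \<and> \<not> ennreal (snd z) < h q (fst z)} \<in> sets P0" if "q \<in> Q" for q
    proof -
      note hp[OF that, measurable]
      show ?thesis by measurable
    qed
    then have "(\<Union>q\<in>Q. {z \<in> space P0. T z = q \<and> \<not> ennreal (snd z) < h q (fst z)}) \<in> sets P0"
      using cQ by (intro sets.countable_UN') auto
    also have "(\<Union>q\<in>Q. {z \<in> space P0. T z = q \<and> \<not> ennreal (snd z) < h q (fst z)}) = {z \<in> space P0. E z}"
      by (auto simp: E_def)
    finally show ?thesis by (simp add: pred_def)
  qed
  have \<zeta>_meas [measurable]: "\<zeta> \<in> P0 \<rightarrow>\<^sub>M \<rho> \<Otimes>\<^sub>M split_borel"
    unfolding \<zeta>_def split_borel_def by measurable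
  have T_le: "T z \<le> \<phi> q z" if "q \<in> Q" for q z
    unfolding T_def using that Q_ab ab by (intro cINF_lower bdd_belowI2[of _ a]) (auto simp: \<phi>_def)
  have T_ge: "a \<le> T z" for z
    unfolding T_def using Q_ab ab Q_ne by (intro cINF_greatest) (auto simp: \<phi>_def)
  have T_le_b: "T z \<le> b" for z
    using T_le[OF bQ, of z] by (auto simp: \<phi>_def split: if_splits)
  have T_less: "\<exists>q\<in>Q. q < t \<and> ennreal (snd z) < h q (fst z)" if "T z < t" "t \<le> b" for z t
  proof -
    have "bdd_below ((\<lambda>q. \<phi> q z) ` Q)"
      using Q_ab ab by (intro bdd_belowI2[of _ a]) (auto simp: \<phi>_def)
    then obtain q where "q \<in> Q" "\<phi> q z < t"
      using \<open>T z < t\<close> cINF_less_iff[OF Q_ne, of "\<lambda>q. \<phi> q z" t] unfolding T_def by blast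
    with \<open>t \<le> b\<close> show ?thesis by (intro bexI[of _ q]) (auto simp: \<phi>_def split: if_splits)
  qed

  have em_P: "emeasure P (A \<times> B) = emeasure P0 {z \<in> space P0. fst z \<in> A \<and> snd (\<zeta> z) \<in> B}"
    if "A \<in> sets \<rho>" "B \<in> sets split_borel" for A B
    unfolding P_def using that
    by (subst emeasure_distr) (auto simp: \<zeta>_def intro!: arg_cong2[where f = emeasure])
  have A_UNIV: "emeasure P (A \<times> UNIV) = emeasure \<rho> A" if A: "A \<in> sets \<rho>" for A
  proof -
    have "emeasure P (A \<times> UNIV) = emeasure P0 (A \<times> space U)"
      using sets.top[of split_borel] em_P[OF A, of UNIV] sets.sets_into_space[OF A]
      by (auto simp: space_P0 space_U intro!: arg_cong2[where f = emeasure])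
    also have "\<dots> = emeasure \<rho> A"
      unfolding P0_def using A by (subst U.emeasure_pair_measure_Times) (auto simp: em_U1)
    finally show ?thesis .
  qed
  have AE_P0: "AE z in P0. p (fst z)" if p: "AE u in \<rho>. p u" for p
  proof -
    have "AE z in \<rho> \<Otimes>\<^sub>M U. p (fst z)"
    proof -
      obtain N where N: "N \<in> null_sets \<rho>" "{u \<in> space \<rho>. \<not> p u} \<subseteq> N"
        using AE_E[OF p] by (metis null_setsI)
      have "N \<times> space U \<in> null_sets (\<rho> \<Otimes>\<^sub>M U)"
        using N by (intro null_setsI) (auto simp: U.emeasure_pair_measure_Times null_sets_def)
      then show ?thesis
        using N(2) by (intro AE_I'[of "N \<times> space U"]) (auto simp: space_pair_measure)
    qed
    then show ?thesis unfolding P0_def .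
  qed
  \<comment> \<open>Outside one null set, \<open>h t\<close> dominates the countably many
    \<open>h q\<close> with \<open>q\<close> up to \<open>t\<close>. There the new point lies below
    the cut at \<open>t\<close> exactly when \<open>\<omega>\<close> is less than
    \<open>h t\<close>, an event of conditional probability \<open>h t\<close>.\<close>
  have below_Q: "emeasure P (A \<times> below t) = emeasure (\<nu> t) A" if A: "A \<in> sets \<rho>" and t: "t \<in> Q" for A t
  proof -
    have tab: "t \<in> {a..b}" using t Q_ab by auto
    have "AE u in \<rho>. \<forall>q\<in>Q. q \<le> t \<longrightarrow> h q u \<le> h t u"
    proof (rule AE_ball_countable'[OF _ cQ])
      fix q assume "q \<in> Q"
      show "AE u in \<rho>. q \<le> t \<longrightarrow> h q u \<le> h t u"
      proof (cases "q \<le> t")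
        case True
        then have "AE u in \<rho>. h q u \<le> h t u"
          using \<open>q \<in> Q\<close> Q_ab tab by (intro h_mono) auto
        then show ?thesis by auto
      qed simp
    qed
    note AE_P0[OF this]
    moreover note AE_P0[OF h_b]
    ultimately have "AE z in P0. snd (\<zeta> z) \<in> below t \<longleftrightarrow> ennreal (snd z) < h t (fst z)"
      using AE_space
    proof eventually_elim
      case (elim z)
      note mono = elim(1) and hb = elim(2)
      show ?case
      proof
        assume z: "snd (\<zeta> z) \<in> below t"
        then consider "T z < t" | "T z = t" "\<not> E z"
          by (auto simp: below_def \<zeta>_def split: if_splits)
        then show "ennreal (snd z) < h t (fst z)"
        proof cases
          case 1
          then obtain q where "q \<in> Q" "q < t" "ennreal (snd z) < h q (fst z)"
            using T_less[of z t] tab by auto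
          then show ?thesis using mono by (auto intro: less_le_trans)
        next
          case 2
          then show ?thesis using t by (auto simp: E_def)
        qed
      next
        assume z: "ennreal (snd z) < h t (fst z)"
        then have "T z \<le> t" using T_le[OF t, of z] by (simp add: \<phi>_def)
        then show "snd (\<zeta> z) \<in> below t"
          using z by (cases "T z = t") (auto simp: below_def \<zeta>_def E_def)
      qed
    qed
    then have AE_iff: "AE z in P0. fst z \<in> A \<and> snd (\<zeta> z) \<in> below t \<longleftrightarrow> fst z \<in> A \<and> ennreal (snd z) < h t (fst z)"
      by (rule eventually_mono) blast
    note hp[OF t, measurable]
    have [measurable]: "A \<in> sets \<rho>" by (rule A)
    have "emeasure P (A \<times> below t) = emeasure P0 {z \<in> space P0. fst z \<in> A \<and> snd (\<zeta> z) \<in> below t}"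
      using A by (rule em_P) simp
    also have "\<dots> = emeasure P0 {z \<in> space P0. fst z \<in> A \<and> ennreal (snd z) < h t (fst z)}"
    proof (rule emeasure_eq_AE)
      show "AE z in P0. z \<in> {z \<in> space P0. fst z \<in> A \<and> snd (\<zeta> z) \<in> below t} \<longleftrightarrow>
          z \<in> {z \<in> space P0. fst z \<in> A \<and> ennreal (snd z) < h t (fst z)}"
        using AE_iff by (rule eventually_mono) blast
      have "(\<lambda>z. snd (\<zeta> z)) \<in> P0 \<rightarrow>\<^sub>M split_borel"
        using \<zeta>_meas by measurable
      then have "Measurable.pred P0 (\<lambda>z. snd (\<zeta> z) \<in> below t)"
        by (rule pred_sets2[OF below_sets])
      note this[measurable]
      show "{z \<in> space P0. fst z \<in> A \<and> snd (\<zeta> z) \<in> below t} \<in> sets P0"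
        by measurable
      show "{z \<in> space P0. fst z \<in> A \<and> ennreal (snd z) < h t (fst z)} \<in> sets P0"
        by measurable
    qed
    also have "\<dots> = (\<integral>\<^sup>+u. emeasure U (Pair u -` {z \<in> space P0. fst z \<in> A \<and> ennreal (snd z) < h t (fst z)}) \<partial>\<rho>)"
    proof -
      have "{z \<in> space P0. fst z \<in> A \<and> ennreal (snd z) < h t (fst z)} \<in> sets P0"
        by measurable
      then show ?thesis
        using U.emeasure_pair_measure_alt[of _ \<rho>] unfolding P0_def by blast
    qed
    also have "\<dots> = (\<integral>\<^sup>+u. h t u * indicator A u \<partial>\<rho>)"
    proof (rule nn_integral_cong_AE)
      show "AE u in \<rho>. emeasure U (Pair u -` {z \<in> space P0. fst z \<in> A \<and> ennreal (snd z) < h t (fst z)}) =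
          h t u * indicator A u"
        using h_le_1[OF tab] AE_space
      proof eventually_elim
        case (elim u)
        have "Pair u -` {z \<in> space P0. fst z \<in> A \<and> ennreal (snd z) < h t (fst z)} =
            (if u \<in> A then {\<omega>\<in>{0..<1}. ennreal \<omega> < h t u} else {})"
          using elim by (auto simp: space_P0)
        then show ?case using em_U[OF elim(1)] by simp
      qed
    qed
    also have "\<dots> = emeasure (\<nu> t) A" by (rule em_h[OF tab A])
    finally show ?thesis .
  qed
  have sets_P: "sets P = sets (\<nu> b \<Otimes>\<^sub>M split_borel)"
    by (simp add: P_def \<rho>_def)
  have P_fin: "finite_measure P"
    unfolding P_def P0_def
    by (intro finite_measure.finite_measure_distr finite_measure_pair_measure)
       (use \<zeta>_meas in \<open>auto simp: P0_def intro: \<rho>.finite_measure_axioms U.finite_measure_axioms\<close>)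
  interpret P: finite_measure P by (rule P_fin)
  have P_mono: "emeasure P (A \<times> B) \<le> emeasure P (A \<times> B')" if "A \<in> sets \<rho>" "B \<subseteq> B'" "B' \<in> sets split_borel" for A B B'
    using that by (intro emeasure_mono) (auto simp: sets_P \<rho>_def)
  \<comment> \<open>For \<open>t\<close> outside \<open>Q\<close>, rationals
    \<open>q < t < r\<close> close to \<open>t\<close> squeeze the mass below the cut: on
    \<open>A\<close>, \<open>\<nu> q\<close> and \<open>\<nu> r\<close> differ from
    \<open>\<nu> t\<close> by at most the small change in \<open>m\<close>.\<close>
  have below_mid: "emeasure P (A \<times> below t) = emeasure (\<nu> t) A" if A: "A \<in> sets \<rho>" and t: "t \<in> {a..b}" for A t
  proof (cases "t \<in> Q")
    case False
    then have cont: "isCont m t" and t': "a < t" "t < b"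
      using t unfolding Q_def by force+
    let ?p = "measure P (A \<times> below t)" and ?v = "measure (\<nu> t) A"
    have P_Q: "measure P (A \<times> below q) = measure (\<nu> q) A" if "q \<in> Q" for q
      using below_Q[OF A that] by (simp add: measure_def)
    have P_mono': "measure P (A \<times> below s) \<le> measure P (A \<times> below r)" if "s \<le> r" for s r
      using P_mono[OF A below_mono[OF that]] by (simp add: P.emeasure_eq_measure)
    have "\<bar>?p - ?v\<bar> \<le> e" if "0 < e" for e
    proof -
      obtain \<delta> where \<delta>: "0 < \<delta>" "\<And>q. \<bar>q - t\<bar> < \<delta> \<Longrightarrow> \<bar>m q - m t\<bar> < e"
        using cont \<open>0 < e\<close> unfolding continuous_at_eps_delta dist_real_def by metis
      obtain q where q: "q \<in> \<rat>" "max a (t - \<delta>) < q" "q < t"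
        using Rats_dense_in_real[of "max a (t - \<delta>)" t] t' \<delta> by auto
      obtain r where r: "r \<in> \<rat>" "t < r" "r < min b (t + \<delta>)"
        using Rats_dense_in_real[of t "min b (t + \<delta>)"] t' \<delta> by auto
      have "q \<in> Q" "r \<in> Q" using q r t' unfolding Q_def by auto
      note 1 = P_Q[OF this(1)] P_Q[OF this(2)]
      have 2: "measure (\<nu> q) A \<le> ?p" "?p \<le> measure (\<nu> r) A"
        using P_mono'[of q t] P_mono'[of t r] q r 1 by auto
      have 3: "?v - measure (\<nu> q) A \<le> m t - m q" "measure (\<nu> r) A - ?v \<le> m r - m t"
        using measure_diff_le[of q t A] measure_diff_le[of t r A] q r t' A by auto
      have "\<bar>m q - m t\<bar> < e" "\<bar>m r - m t\<bar> < e"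
        using q r \<delta> by auto
      with 2 3 show ?thesis by linarith
    qed
    then have "?p = ?v"
      by (metis abs_ge_zero eq_iff_diff_eq_0 abs_eq_0 field_le_epsilon add_0 order_antisym)
    then show ?thesis
      using P.emeasure_eq_measure finite_measure.emeasure_eq_measure[OF fin_\<nu>[OF t]] by simp
  qed (use below_Q[OF A] in auto)
  show thesis
  proof (rule that[OF sets_P P_fin cQ])
    have *: "{z \<in> space (\<rho> \<Otimes>\<^sub>M split_borel). snd (snd z) = L \<longrightarrow> fst (snd z) \<in> Q} \<in> sets (\<rho> \<Otimes>\<^sub>M split_borel)"
    proof -
      note countable_borel[OF cQ, measurable]
      show ?thesis by measurable
    qed
    show "AE z in P. snd (snd z) = L \<longrightarrow> fst (snd z) \<in> Q"
      unfolding P_def by (subst AE_distr_iff[OF \<zeta>_meas *]) (auto simp: \<zeta>_def E_def)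
    show "emeasure P (A \<times> UNIV) = emeasure (\<nu> b) A" if "A \<in> sets (\<nu> b)" for A
      using A_UNIV that by (simp add: \<rho>_def)
    show "emeasure P (A \<times> below t) =
        (if t < a then 0 else if t \<le> b then emeasure (\<nu> t) A else emeasure (\<nu> b) A)"
      if "A \<in> sets (\<nu> b)" for A t
    proof -
      have A: "A \<in> sets \<rho>" using that by (simp add: \<rho>_def)
      consider "t < a" | "t \<in> {a..b}" | "b < t" by force
      then show ?thesis
      proof cases
        case 1
        then have "snd (\<zeta> z) \<notin> below t" for z
          using T_ge[of z] by (auto simp: below_def \<zeta>_def)
        then show ?thesis using 1 em_P[OF A below_sets] by simp
      next
        case 2
        then show ?thesis using below_mid[OF A 2] by simp
      next
        case 3
        then have "snd (\<zeta> z) \<in> below t" for z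
          using T_le_b[of z] by (auto simp: below_def \<zeta>_def)
        then have "emeasure P (A \<times> below t) = emeasure P (A \<times> UNIV)"
          using em_P[OF A below_sets[of t]] em_P[OF A, of UNIV] sets.top[of split_borel] by simp
        then show ?thesis using 3 ab A_UNIV[OF A] by (simp add: \<rho>_def)
      qed
    qed
  qed
qed

section \<open>Existence for clamped functions\<close>

definition clp :: "('i \<Rightarrow> real) \<Rightarrow> ('i \<Rightarrow> real) \<Rightarrow> ('i \<Rightarrow> real) \<Rightarrow> 'i \<Rightarrow> real" where
  "clp a b x = (\<lambda>i. max (a i) (min (b i) (x i)))"

lemma clp_mono: "x i \<le> y i \<Longrightarrow> clp a b x i \<le> clp a b y i"
  by (auto simp: clp_def max_def min_def)

lemma clp_in: "a i \<le> b i \<Longrightarrow> clp a b x i \<in> {a i..b i}"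
  by (auto simp: clp_def)

text \<open>Unlike those of \<open>gap_Int\<close>, the new cut points stay ordered and inside
  \<open>[a, b]\<close> even if the gaps do not meet, so mixed differences of the given function can
  be taken there.\<close>

lemma gap_Int_clp:
  assumes "s \<le> t" "a \<le> b"
  shows "gap s t \<inter> gap a b = gap (max a (min b s)) (max a (min b t))"
  using assms by (auto simp: gap_def below_def max_def min_def split: if_splits)

lemma gapbox_Int_clp:
  assumes "\<And>i. x i \<le> y i" "\<And>i. a i \<le> b i"
  shows "gapbox d x y \<inter> gapbox d a b = gapbox d (clp a b x) (clp a b y)"
  unfolding gapbox_def PiE_Int clp_def using gap_Int_clp assms by simp

text \<open>With the exceptional set made explicit, \<open>left_parts_in\<close> says that one mass
  vanishes, a condition inherited by sums and suprema of measures.\<close>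

definition left_exc :: "nat \<Rightarrow> real set \<Rightarrow> (nat \<Rightarrow> real \<times> side) set" where
  "left_exc d C = {z \<in> space (split_space d). \<not> (\<forall>j\<in>{1..d}. snd (z j) = L \<longrightarrow> fst (z j) \<in> C)}"

lemma left_exc_sets:
  assumes "countable C"
  shows "left_exc d C \<in> sets (split_space d)"
  using sets.Diff[OF sets.top left_parts_sets[OF assms, of d]]
  by (auto simp: left_exc_def intro: back_subst[of "\<lambda>A. A \<in> sets (split_space d)"])

lemma left_parts_in_iff:
  assumes "countable C" "sets N = sets (split_space d)"
  shows "left_parts_in d C N \<longleftrightarrow> emeasure N (left_exc d C) = 0"
  unfolding left_parts_in_def
  using left_exc_sets[OF assms(1), of d] sets_eq_imp_space_eq[OF assms(2)] assms(2)
  by (intro AE_iff_measurable) (auto simp: left_exc_def)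

lemma left_parts_in_mono: "left_parts_in d C N \<Longrightarrow> C \<subseteq> C' \<Longrightarrow> left_parts_in d C' N"
  unfolding left_parts_in_def by (auto elim: eventually_mono)

lemma UNIV_side: "(UNIV :: side set) = {L, R}"
  using side.exhaust by auto

lemma measure_of_sum_measures:
  assumes "finite K" "\<And>k. k \<in> K \<Longrightarrow> sets (M k) = sets S"
  obtains N where "sets N = sets S" "\<And>A. A \<in> sets S \<Longrightarrow> emeasure N A = (\<Sum>k\<in>K. emeasure (M k) A)"
proof
  let ?N = "measure_of (space S) (sets S) (\<lambda>A. \<Sum>k\<in>K. emeasure (M k) A)"
  show "sets ?N = sets S"
    by (rule sets.sets_measure_of_eq)
  show "emeasure ?N A = (\<Sum>k\<in>K. emeasure (M k) A)" if "A \<in> sets S" for A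
  proof (rule emeasure_measure_of_sigma)
    show "sigma_algebra (space S) (sets S)" ..
    show "positive (sets S) (\<lambda>A. \<Sum>k\<in>K. emeasure (M k) A)"
      by (simp add: positive_def)
    show "countably_additive (sets S) (\<lambda>A. \<Sum>k\<in>K. emeasure (M k) A)"
    proof (rule countably_additiveI)
      fix A :: "nat \<Rightarrow> _" assume A: "range A \<subseteq> sets S" "disjoint_family A"
      have "(\<Sum>i. \<Sum>k\<in>K. emeasure (M k) (A i)) = (\<Sum>k\<in>K. \<Sum>i. emeasure (M k) (A i))"
        by (rule suminf_sum) auto
      also have "\<dots> = (\<Sum>k\<in>K. emeasure (M k) (\<Union>i. A i))"
        using A assms(2) by (intro sum.cong refl suminf_emeasure) auto
      finally show "(\<Sum>i. \<Sum>k\<in>K. emeasure (M k) (A i)) = (\<Sum>k\<in>K. emeasure (M k) (\<Union>i. A i))" .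
    qed
  qed (rule that)
qed

lemma measure_of_SUP_measures:
  fixes M :: "nat \<Rightarrow> 'a measure"
  assumes "\<And>n. sets (M n) = sets S" "\<And>A. A \<in> sets S \<Longrightarrow> incseq (\<lambda>n. emeasure (M n) A)"
  obtains N where "sets N = sets S" "\<And>A. A \<in> sets S \<Longrightarrow> emeasure N A = (SUP n. emeasure (M n) A)"
proof
  let ?N = "measure_of (space S) (sets S) (\<lambda>A. SUP n. emeasure (M n) A)"
  show "sets ?N = sets S"
    by (rule sets.sets_measure_of_eq)
  show "emeasure ?N A = (SUP n. emeasure (M n) A)" if "A \<in> sets S" for A
  proof (rule emeasure_measure_of_sigma)
    show "sigma_algebra (space S) (sets S)" ..
    show "positive (sets S) (\<lambda>A. SUP n. emeasure (M n) A)"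
      by (simp add: positive_def)
    show "countably_additive (sets S) (\<lambda>A. SUP n. emeasure (M n) A)"
    proof (rule countably_additiveI)
      fix A :: "nat \<Rightarrow> _" assume A: "range A \<subseteq> sets S" "disjoint_family A"
      have "(\<Sum>i. SUP n. emeasure (M n) (A i)) = (SUP n. \<Sum>i. emeasure (M n) (A i))"
        using A assms(2) by (intro ennreal_suminf_SUP_eq) auto
      also have "\<dots> = (SUP n. emeasure (M n) (\<Union>i. A i))"
        using A assms(1) by (intro SUP_cong refl suminf_emeasure) auto
      finally show "(\<Sum>i. SUP n. emeasure (M n) (A i)) = (SUP n. emeasure (M n) (\<Union>i. A i))" .
    qed
  qed (rule that)
qed

text \<open>Increments in the last variable are functions of \<open>d\<close> variables whose mixed
  differences are mixed differences of \<open>F\<close>; this carries nonnegativity to the induction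
  hypothesis.\<close>

lemma mdiff_slice:
  "mdiff d x y (\<lambda>v. F (v(Suc d := t)) - F (v(Suc d := s))) =
   mdiff (Suc d) (x(Suc d := s)) (y(Suc d := t)) F"
  by (auto intro!: mdiff_cong_pts)

text \<open>Clamping keeps all masses finite, and increments between slices at levels in the
  clamping interval are clamped again, so the induction stays within such functions. Each step adds
  one coordinate by \<open>increasing_measures_lift\<close>.\<close>

lemma exists_finite_split_measure:
  assumes ab: "\<And>i. a i \<le> b i"
    and nonneg: "\<And>x y. (\<And>j. x j \<le> y j) \<Longrightarrow> 0 \<le> mdiff d x y F"
    and clamped: "\<And>x y. mdiff d x y F = mdiff d (clp a b x) (clp a b y) F"
  shows "\<exists>N C. sets N = sets (split_space d) \<and> finite_measure N \<and> countable C \<and> left_parts_in d C N \<and>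
    (\<forall>x y. (\<forall>j. x j \<le> y j) \<longrightarrow> emeasure N (gapbox d x y) = ennreal (mdiff d x y F))"
  using nonneg clamped
proof (induction d arbitrary: F)
  case 0
  \<comment> \<open>The empty product has one point, which carries the value of \<open>F\<close> as
    its mass.\<close>
  let ?N = "scale_measure (ennreal (F (\<lambda>_. undefined))) (split_space 0)"
  have sp: "split_space 0 = count_space {\<lambda>_. undefined}"
    by (simp add: split_space_def PiM_empty)
  have "finite_measure ?N"
    by (rule finite_measureI) (simp add: sp space_scale_measure ennreal_mult_eq_top_iff)
  then show ?case
    by (intro exI[of _ ?N] exI[of _ "{}"]) (auto simp: left_parts_in_def gapbox_def sp)
next
  case (Suc d)
  let ?k = "Suc d"
  define G where "G s t v = F (v(?k := t)) - F (v(?k := s))" for s t v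
  have G_slice: "mdiff d x y (G s t) = mdiff ?k (x(?k := s)) (y(?k := t)) F" for x y s t
    unfolding G_def by (rule mdiff_slice)
  have G_nonneg: "0 \<le> mdiff d x y (G s t)" if "\<And>j. x j \<le> y j" "s \<le> t" for x y s t
    unfolding G_slice using that by (intro Suc.prems) auto
  have G_clp: "mdiff d x y (G s t) = mdiff d (clp a b x) (clp a b y) (G s t)"
    if "s \<in> {a ?k..b ?k}" "t \<in> {a ?k..b ?k}" for x y s t
  proof -
    have "clp a b (x(?k := s)) = (clp a b x)(?k := s)" "clp a b (y(?k := t)) = (clp a b y)(?k := t)"
      using that by (auto simp: clp_def fun_eq_iff)
    then show ?thesis
      unfolding G_slice using Suc.prems(2)[of "x(?k := s)" "y(?k := t)"] by (simp only:)
  qed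
  have G_add: "mdiff d x y (G r s) + mdiff d x y (G s t) = mdiff d x y (G r t)" for x y r s t
    unfolding mdiff_add[symmetric] by (simp add: G_def[abs_def])
  have ex: "\<exists>N C. sets N = sets (split_space d) \<and> finite_measure N \<and> countable C \<and> left_parts_in d C N \<and>
    (\<forall>x y. (\<forall>j. x j \<le> y j) \<longrightarrow> emeasure N (gapbox d x y) = ennreal (mdiff d x y (G s t)))"
    if "a ?k \<le> s" "s \<le> t" "t \<le> b ?k" for s t
    using that by (intro Suc.IH G_nonneg G_clp) auto
  have "\<forall>t. \<exists>N C. t \<in> {a ?k..b ?k} \<longrightarrow> sets N = sets (split_space d) \<and> finite_measure N \<and> countable C \<and> left_parts_in d C N \<and>
    (\<forall>x y. (\<forall>j. x j \<le> y j) \<longrightarrow> emeasure N (gapbox d x y) = ennreal (mdiff d x y (G (a ?k) t)))"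
    using ex[of "a ?k"] by auto
  then obtain \<nu> C where \<nu>C: "\<And>t. t \<in> {a ?k..b ?k} \<Longrightarrow> sets (\<nu> t) = sets (split_space d) \<and> finite_measure (\<nu> t) \<and>
      countable (C t) \<and> left_parts_in d (C t) (\<nu> t) \<and>
      (\<forall>x y. (\<forall>j. x j \<le> y j) \<longrightarrow> emeasure (\<nu> t) (gapbox d x y) = ennreal (mdiff d x y (G (a ?k) t)))"
    by metis
  then have sets_\<nu>: "sets (\<nu> t) = sets (split_space d)" and fin_\<nu>: "finite_measure (\<nu> t)"
    and C: "countable (C t)" "left_parts_in d (C t) (\<nu> t)"
    and em_\<nu>: "\<And>x y. (\<And>j. x j \<le> y j) \<Longrightarrow> emeasure (\<nu> t) (gapbox d x y) = ennreal (mdiff d x y (G (a ?k) t))"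
    if "t \<in> {a ?k..b ?k}" for t
    using that by blast+
  have bk: "b ?k \<in> {a ?k..b ?k}"
    using ab by auto
  \<comment> \<open>The increment from \<open>s\<close> to \<open>t\<close> has a measure
    \<open>N\<close> of its own. The sum of \<open>\<nu> s\<close> and \<open>N\<close> has the box
    masses of \<open>\<nu> t\<close>, so it equals \<open>\<nu> t\<close> by uniqueness.\<close>
  have mono_\<nu>: "emeasure (\<nu> s) A \<le> emeasure (\<nu> t) A"
    if st: "a ?k \<le> s" "s \<le> t" "t \<le> b ?k" and A: "A \<in> sets (split_space d)" for s t A
  proof -
    have s: "s \<in> {a ?k..b ?k}" and t: "t \<in> {a ?k..b ?k}" using st by auto
    obtain N D where N: "sets N = sets (split_space d)" "countable D" "left_parts_in d D N"
      and em_N: "\<And>x y. (\<forall>j. x j \<le> y j) \<longrightarrow> emeasure N (gapbox d x y) = ennreal (mdiff d x y (G s t))"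
      using ex[OF st] by blast
    obtain N' where N': "sets N' = sets (split_space d)"
      and em_N': "\<And>A. A \<in> sets (split_space d) \<Longrightarrow>
        emeasure N' A = (\<Sum>k\<in>UNIV. emeasure (case k of L \<Rightarrow> \<nu> s | R \<Rightarrow> N) A)"
      by (rule measure_of_sum_measures[of "UNIV :: side set" "\<lambda>k. case k of L \<Rightarrow> \<nu> s | R \<Rightarrow> N" "split_space d"])
         (auto split: side.splits simp: sets_\<nu>[OF s] N UNIV_side)
    have em_N': "emeasure N' A = emeasure (\<nu> s) A + emeasure N A" if "A \<in> sets (split_space d)" for A
      unfolding em_N'[OF that] by (simp add: UNIV_side)
    let ?D = "C s \<union> C t \<union> D"
    have cD: "countable ?D" using C s t N by auto
    have "N' = \<nu> t"
    proof (rule split_measure_eqI[OF N' sets_\<nu>[OF t] cD])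
      have "left_parts_in d ?D (\<nu> s)" "left_parts_in d ?D N"
        using C(2)[OF s] N(3) by (auto elim: left_parts_in_mono)
      then have "emeasure N' (left_exc d ?D) = 0"
        using em_N'[OF left_exc_sets[OF cD]] left_parts_in_iff[OF cD] sets_\<nu>[OF s] N by simp
      then show "left_parts_in d ?D N'"
        using left_parts_in_iff[OF cD N'] by simp
      show "left_parts_in d ?D (\<nu> t)"
        using C(2)[OF t] by (auto elim: left_parts_in_mono)
      fix x y :: "nat \<Rightarrow> real" assume xy: "\<And>j. x j \<le> y j"
      have "emeasure N' (gapbox d x y) = ennreal (mdiff d x y (G (a ?k) s)) + ennreal (mdiff d x y (G s t))"
        using em_N'[OF gapbox_sets] em_\<nu>[OF s xy] em_N xy by simp
      also have "\<dots> = ennreal (mdiff d x y (G (a ?k) t))"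
        using xy st by (simp add: ennreal_plus[symmetric] G_nonneg G_add del: ennreal_plus)
      finally have *: "emeasure N' (gapbox d x y) = ennreal (mdiff d x y (G (a ?k) t))" .
      then show "emeasure N' (gapbox d x y) = emeasure (\<nu> t) (gapbox d x y)"
        using em_\<nu>[OF t xy] by simp
      show "emeasure N' (gapbox d x y) \<noteq> \<infinity>"
        using * by simp
    qed
    then show ?thesis using em_N'[OF A] by simp
  qed
  obtain P Q where P: "sets P = sets (\<nu> (b ?k) \<Otimes>\<^sub>M split_borel)" "finite_measure P" and Q: "countable Q"
    and AE_Q: "AE z in P. snd (snd z) = L \<longrightarrow> fst (snd z) \<in> Q"
    and P_UNIV: "\<And>A. A \<in> sets (\<nu> (b ?k)) \<Longrightarrow> emeasure P (A \<times> UNIV) = emeasure (\<nu> (b ?k)) A"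
    and P_below: "\<And>A t. A \<in> sets (\<nu> (b ?k)) \<Longrightarrow> emeasure P (A \<times> below t) =
        (if t < a ?k then 0 else if t \<le> b ?k then emeasure (\<nu> t) A else emeasure (\<nu> (b ?k)) A)"
    by (rule increasing_measures_lift[of "a ?k" "b ?k" \<nu>]) (use ab mono_\<nu> sets_\<nu> fin_\<nu> bk in auto)
  interpret P: finite_measure P by (rule P)
  have sets_P: "sets P = sets (split_space d \<Otimes>\<^sub>M split_borel)"
    unfolding P(1) using sets_\<nu>[OF bk] by (intro sets_pair_measure_cong) auto
  have space_P: "space P = Pi\<^sub>E {1..d} (\<lambda>_. UNIV) \<times> UNIV"
    using sets_eq_imp_space_eq[OF sets_P] by (simp add: space_pair_measure space_split_space)
  define \<eta> where "\<eta> z = (fst z)(?k := snd z)" for z :: "(nat \<Rightarrow> real \<times> side) \<times> (real \<times> side)"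
  have \<eta>: "\<eta> \<in> P \<rightarrow>\<^sub>M split_space ?k"
  proof -
    have "\<eta> \<in> split_space d \<Otimes>\<^sub>M split_borel \<rightarrow>\<^sub>M split_space ?k"
      unfolding \<eta>_def split_space_def by (intro measurable_fun_upd[where J = "{1..d}"]) auto
    then show ?thesis using measurable_cong_sets[OF sets_P refl] by blast
  qed
  define N where "N = distr P (split_space ?k) \<eta>"
  have sets_N: "sets N = sets (split_space ?k)" by (simp add: N_def)
  have fin_N: "finite_measure N"
    unfolding N_def by (rule P.finite_measure_distr[OF \<eta>])
  define D where "D = C (b ?k) \<union> Q"
  have cD: "countable D" using Q C bk by (auto simp: D_def)
  have left_N: "left_parts_in ?k D N"
  proof -
    have "left_parts_in d D (\<nu> (b ?k))"
      using C(2)[OF bk] by (auto elim: left_parts_in_mono simp: D_def)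
    then have "emeasure (\<nu> (b ?k)) (left_exc d D) = 0"
      using left_parts_in_iff[OF cD sets_\<nu>[OF bk]] by simp
    then have "emeasure P (left_exc d D \<times> UNIV) = 0"
      using P_UNIV[of "left_exc d D"] left_exc_sets[OF cD] sets_\<nu>[OF bk] by simp
    moreover have "left_exc d D \<times> UNIV \<in> sets P"
      unfolding sets_P using left_exc_sets[OF cD, of d] sets.top[of split_borel] by auto
    ultimately have "AE z in P. z \<notin> left_exc d D \<times> UNIV"
      by (intro AE_not_in) auto
    then have "AE z in P. \<forall>j\<in>{1..?k}. snd (\<eta> z j) = L \<longrightarrow> fst (\<eta> z j) \<in> D"
      using AE_Q AE_space
    proof eventually_elim
      case (elim z)
      then have "\<forall>j\<in>{1..d}. snd (fst z j) = L \<longrightarrow> fst (fst z j) \<in> D"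
        by (auto simp: left_exc_def space_P space_split_space mem_Times_iff)
      moreover have "snd (snd z) = L \<longrightarrow> fst (snd z) \<in> D"
        using elim by (auto simp: D_def)
      ultimately show ?case
        unfolding atLeastAtMost_1_Suc by (auto simp: \<eta>_def)
    qed
    then show ?thesis
      unfolding left_parts_in_def N_def
      by (subst AE_distr_iff[OF \<eta> left_parts_sets[OF cD]])
  qed
  have "emeasure N (gapbox ?k x y) = ennreal (mdiff ?k x y F)" if xy: "\<And>j. x j \<le> y j" for x y
  proof -
    let ?A = "gapbox d x y" and ?cx = "clp a b x ?k" and ?cy = "clp a b y ?k"
    have A: "?A \<in> sets (split_space d)" "?A \<in> sets (\<nu> (b ?k))"
      using sets_\<nu>[OF bk] by auto
    have P_G: "emeasure P (?A \<times> below t) = ennreal (mdiff d x y (G (a ?k) (max (a ?k) (min (b ?k) t))))" for t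
    proof -
      have 0: "mdiff d x y (G r r) = 0" for r
        by (simp add: G_def[abs_def] mdiff_0)
      consider "t < a ?k" | "t \<in> {a ?k..b ?k}" | "b ?k < t" by force
      then show ?thesis
      proof cases
        case 1
        then show ?thesis using P_below[OF A(2), of t] ab[of ?k] 0 by (simp add: max_def min_def)
      next
        case 2
        then have "max (a ?k) (min (b ?k) t) = t" by auto
        then show ?thesis using 2 P_below[OF A(2), of t] em_\<nu>[OF 2 xy] by simp
      next
        case 3
        then show ?thesis using P_below[OF A(2), of t] em_\<nu>[OF bk xy] ab[of ?k] by (simp add: max_def min_def)
      qed
    qed
    have "\<eta> -` gapbox ?k x y \<inter> space P = ?A \<times> gap (x ?k) (y ?k)"
      unfolding gapbox_def space_P atLeastAtMost_1_Suc
      by (auto simp: \<eta>_def PiE_iff extensional_def split: if_splits)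
    then have "emeasure N (gapbox ?k x y) = emeasure P (?A \<times> gap (x ?k) (y ?k))"
      unfolding N_def using \<eta> by (simp add: emeasure_distr)
    also have "?A \<times> gap (x ?k) (y ?k) = ?A \<times> below (y ?k) - ?A \<times> below (x ?k)"
      by (auto simp: gap_def)
    also have "emeasure P \<dots> = emeasure P (?A \<times> below (y ?k)) - emeasure P (?A \<times> below (x ?k))"
      using A below_mono[OF xy[of ?k]]
      by (intro emeasure_Diff) (auto simp: sets_P P.emeasure_finite)
    also have "\<dots> = ennreal (mdiff d x y (G (a ?k) ?cy)) - ennreal (mdiff d x y (G (a ?k) ?cx))"
      by (simp only: P_G clp_def)
    also have "\<dots> = ennreal (mdiff d x y (G ?cx ?cy))"
    proof -
      have "0 \<le> mdiff d x y (G (a ?k) ?cx)"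
        using xy by (intro G_nonneg) (auto simp: clp_def)
      moreover have "mdiff d x y (G ?cx ?cy) = mdiff d x y (G (a ?k) ?cy) - mdiff d x y (G (a ?k) ?cx)"
        using G_add[of x y "a ?k" ?cx ?cy] by linarith
      ultimately show ?thesis by (simp only: ennreal_minus)
    qed
    \<comment> \<open>So far only the last pair of cut points is clamped. Clamping all of them is
      harmless, absorbs the inner clamp, and can then be undone.\<close>
    also have "mdiff d x y (G ?cx ?cy) = mdiff ?k (x(?k := ?cx)) (y(?k := ?cy)) F"
      by (rule G_slice)
    also have "\<dots> = mdiff ?k (clp a b (x(?k := ?cx))) (clp a b (y(?k := ?cy))) F"
      by (rule Suc.prems(2))
    also have "\<dots> = mdiff ?k (clp a b x) (clp a b y) F"
      using ab[of ?k] by (intro mdiff_cong_pts) (auto simp: clp_def)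
    also have "\<dots> = mdiff ?k x y F"
      by (rule Suc.prems(2)[symmetric])
    finally show ?thesis .
  qed
  then show ?case
    using sets_N fin_N cD left_N by blast
qed

section \<open>Exhaustion of the box\<close>

text \<open>The end points are minimum and maximum of the first rational points of \<open>I\<close>,
  which treats bounded and unbounded intervals alike. Openness puts rational points of
  \<open>I\<close> on both sides of every \<open>u\<close>.\<close>

lemma open_interval_exhaustion:
  fixes I :: "real set"
  assumes "open I" "I \<noteq> {}"
  obtains a b :: "nat \<Rightarrow> real" where "decseq a" "incseq b"
    "\<And>n. a n \<in> I" "\<And>n. b n \<in> I" "\<And>n. a n \<le> b n"
    "\<And>u. u \<in> I \<Longrightarrow> \<exists>n. a n < u \<and> u < b n"
proof
  define c where "c = from_nat_into (\<rat> \<inter> I)"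
  define a where "a n = Min (c ` {..n})" for n
  define b where "b n = Max (c ` {..n})" for n
  have near: "\<exists>q\<in>\<rat> \<inter> I. q < u" "\<exists>q\<in>\<rat> \<inter> I. u < q" if "u \<in> I" for u
  proof -
    obtain e where e: "0 < e" "\<And>v. dist v u < e \<Longrightarrow> v \<in> I"
      using assms(1) \<open>u \<in> I\<close> unfolding open_dist by blast
    obtain q where "q \<in> \<rat>" "u - e < q" "q < u"
      using Rats_dense_in_real[of "u - e" u] e(1) by auto
    then show "\<exists>q\<in>\<rat> \<inter> I. q < u"
      using e(2)[of q] by (auto simp: dist_real_def)
    obtain q where "q \<in> \<rat>" "u < q" "q < u + e"
      using Rats_dense_in_real[of u "u + e"] e(1) by auto
    then show "\<exists>q\<in>\<rat> \<inter> I. u < q"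
      using e(2)[of q] by (auto simp: dist_real_def)
  qed
  have ne: "\<rat> \<inter> I \<noteq> {}" using near(1) assms(2) by blast
  have "countable (\<rat> \<inter> I)" using countable_rat by auto
  then have c: "range c = \<rat> \<inter> I"
    unfolding c_def using ne by (intro range_from_nat_into)
  show "decseq a" unfolding a_def
    by (intro antimonoI Min_antimono) auto
  show "incseq b" unfolding b_def
    by (intro monoI Max_mono) auto
  have "a n \<in> c ` {..n}" "b n \<in> c ` {..n}" for n
    unfolding a_def b_def by (intro Min_in Max_in; auto)+
  then show "a n \<in> I" "b n \<in> I" for n
    using c by blast+
  show "a n \<le> b n" for n
    unfolding a_def b_def by (intro Min.coboundedI[THEN order_trans, OF _ _ Max.coboundedI, of _ "c 0"]) auto
  fix u assume "u \<in> I"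
  obtain k l where "c k < u" "u < c l"
    using near[OF \<open>u \<in> I\<close>] c by (metis imageE)
  moreover have "a (max k l) \<le> c k" "c l \<le> b (max k l)"
    unfolding a_def b_def by (intro Min.coboundedI Max.coboundedI; simp)+
  ultimately show "\<exists>n. a n < u \<and> u < b n"
    by (intro exI[of _ "max k l"]) auto
qed

lemma open_box_exhaustion:
  fixes I :: "nat \<Rightarrow> real set"
  assumes "\<And>i. i \<in> {1..d} \<Longrightarrow> open (I i)" "\<And>i. i \<in> {1..d} \<Longrightarrow> I i \<noteq> {}"
  obtains a b :: "nat \<Rightarrow> nat \<Rightarrow> real" where
    "\<forall>n i. a n i \<le> b n i" "\<forall>n m i. n \<le> m \<longrightarrow> a m i \<le> a n i \<and> b n i \<le> b m i"
    "\<forall>n. \<forall>i\<in>{1..d}. a n i \<in> I i \<and> b n i \<in> I i"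
    "\<forall>x. (\<forall>i\<in>{1..d}. x i \<in> I i) \<longrightarrow> (\<exists>n. \<forall>i\<in>{1..d}. a n i < x i \<and> x i < b n i)"
proof -
  \<comment> \<open>The whole line outside \<open>{1..d}\<close> makes \<open>a n i <= b n i\<close>
    available at every index, as the clamping lemmas require.\<close>
  define J where "J i = (if i \<in> {1..d} then I i else UNIV)" for i
  have "\<exists>a b. decseq a \<and> incseq b \<and> (\<forall>n::nat. a n \<in> J i \<and> b n \<in> J i \<and> a n \<le> b n) \<and>
      (\<forall>u\<in>J i. \<exists>n. a n < u \<and> u < b n)" for i
  proof -
    have "open (J i)" "J i \<noteq> {}" using assms by (auto simp: J_def)
    from open_interval_exhaustion[OF this] show ?thesis by metis
  qed
  then obtain a b where ab: "\<And>i. decseq (a i)" "\<And>i. incseq (b i)"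
    "\<And>i n::nat. a i n \<in> J i \<and> b i n \<in> J i \<and> a i n \<le> b i n"
    "\<And>i u. u \<in> J i \<Longrightarrow> \<exists>n. a i n < u \<and> u < b i n"
    by metis
  have mono: "a i m \<le> a i n \<and> b i n \<le> b i m" if "n \<le> m" for n m i
    using ab(1,2) that by (auto simp: monotone_def)
  have cover: "\<exists>n. \<forall>i\<in>{1..d}. a i n < x i \<and> x i < b i n" if x: "\<forall>i\<in>{1..d}. x i \<in> I i" for x
  proof -
    have "\<exists>n. a i n < x i \<and> x i < b i n" if "i \<in> {1..d}" for i
      using ab(4)[of "x i" i] x that by (auto simp: J_def)
    then obtain k where k: "\<And>i. i \<in> {1..d} \<Longrightarrow> a i (k i) < x i \<and> x i < b i (k i)"
      by metis
    have "a i (Max (k ` {1..d})) < x i \<and> x i < b i (Max (k ` {1..d}))" if i: "i \<in> {1..d}" for i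
    proof -
      have "k i \<le> Max (k ` {1..d})" using i by (intro Max_ge) auto
      from mono[OF this] k[OF i] show ?thesis by (meson le_less_trans less_le_trans)
    qed
    then show ?thesis by blast
  qed
  show thesis
  proof (rule that[of "\<lambda>n i. a i n" "\<lambda>n i. b i n"])
    show "\<forall>n. \<forall>i\<in>{1..d}. a i n \<in> I i \<and> b i n \<in> I i"
    proof (intro allI ballI)
      fix n i assume "i \<in> {1..d}"
      then show "a i n \<in> I i \<and> b i n \<in> I i"
        using ab(3)[of i n] by (simp add: J_def)
    qed
  qed (use ab(3) mono cover in auto)
qed

text \<open>For nested intervals the smaller one prevails in either order; this makes the measures
  for different compact boxes consistent.\<close>

lemma clamp_clamp:
  fixes a b a' b' t :: real
  assumes "a \<le> b" "a' \<le> a \<and> b \<le> b'"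
  shows "max a (min b (max a' (min b' t))) = max a (min b t)"
    and "max a' (min b' (max a (min b t))) = max a (min b t)"
proof -
  consider "t < a" | "a \<le> t" "t \<le> b" | "b < t" by linarith
  then have "max a (min b (max a' (min b' t))) = max a (min b t) \<and>
      max a' (min b' (max a (min b t))) = max a (min b t)"
    using assms by cases (auto simp: max_def min_def)
  then show "max a (min b (max a' (min b' t))) = max a (min b t)"
    "max a' (min b' (max a (min b t))) = max a (min b t)" by blast+
qed

section \<open>Restriction to compact boxes and passage to the limit\<close>

lemma left_parts_in_restricted:
  assumes "left_parts_in d C N" "B \<in> sets N"
  shows "left_parts_in d C (density N (indicator B))"
proof -
  have "indicator B \<in> borel_measurable N" using assms(2) by simp
  then show ?thesis
    using assms(1) unfolding left_parts_in_def
    by (subst AE_density) (auto elim: eventually_mono)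
qed

text \<open>Singles out the measures on the split power that can come from a family on the open box.
  Mass outside the box is excluded because gap boxes with cut points in \<open>I\<close> cannot
  detect it.\<close>

definition carried_by :: "nat \<Rightarrow> (nat \<Rightarrow> real set) \<Rightarrow> (nat \<Rightarrow> real \<times> side) measure \<Rightarrow> bool" where
  "carried_by d I N \<longleftrightarrow> sets N = sets (split_space d) \<and> (\<exists>C. countable C \<and> left_parts_in d C N) \<and>
     (AE z in N. \<forall>j\<in>{1..d}. fst (z j) \<in> I j)"

lemma gapbox_in_intervals:
  assumes "z \<in> gapbox d a b" "j \<in> {1..d}" "a j \<in> I j" "b j \<in> I j" "is_interval (I j)"
  shows "fst (z j) \<in> I j"
proof -
  have "z j \<in> gap (a j) (b j)"
    using assms(1,2) by (auto simp: gapbox_def)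
  from gap_subset[OF this] show ?thesis
    using assms(3-5) unfolding is_interval_1 by blast
qed

text \<open>Masses are known only for cut points in \<open>I\<close>. Restriction to an exhausting
  box replaces arbitrary cut points by clamped ones, which lie in \<open>I\<close>, so
  \<open>split_measure_eqI\<close> applies; the full measures are limits of these
  restrictions.\<close>

lemma split_measure_eqI_on:
  assumes I: "\<And>i. i \<in> {1..d} \<Longrightarrow> open (I i)" "\<And>i. i \<in> {1..d} \<Longrightarrow> is_interval (I i)"
      "\<And>i. i \<in> {1..d} \<Longrightarrow> I i \<noteq> {}"
    and N: "carried_by d I N" "carried_by d I N'"
    and eq: "\<And>x y. (\<And>j. j \<in> {1..d} \<Longrightarrow> x j \<in> I j \<and> y j \<in> I j \<and> x j \<le> y j) \<Longrightarrow>
        emeasure N (gapbox d x y) = emeasure N' (gapbox d x y) \<and> emeasure N (gapbox d x y) \<noteq> \<infinity>"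
  shows "N = N'"
proof (rule measure_eqI)
  obtain a b :: "nat \<Rightarrow> nat \<Rightarrow> real" where ab':
    "\<forall>n i. a n i \<le> b n i" "\<forall>n m i. n \<le> m \<longrightarrow> a m i \<le> a n i \<and> b n i \<le> b m i"
    "\<forall>n. \<forall>i\<in>{1..d}. a n i \<in> I i \<and> b n i \<in> I i"
    "\<forall>x. (\<forall>i\<in>{1..d}. x i \<in> I i) \<longrightarrow> (\<exists>n. \<forall>i\<in>{1..d}. a n i < x i \<and> x i < b n i)"
    by (rule open_box_exhaustion[of d I, OF I(1,3)])
  note ab = ab'[rule_format]
  define B where "B n = gapbox d (a n) (b n)" for n
  have B_sets [measurable]: "B n \<in> sets (split_space d)" for n
    by (simp add: B_def)
  obtain C C' where C: "countable C" "left_parts_in d C N" and C': "countable C'" "left_parts_in d C' N'"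
    using N unfolding carried_by_def by blast
  have sN: "sets N = sets (split_space d)" and sN': "sets N' = sets (split_space d)"
    using N unfolding carried_by_def by auto
  have clp_I: "clp (a n) (b n) x j \<in> I j" if "j \<in> {1..d}" for n x j
    using ab(3)[OF that, of n] clp_in[of "a n" j "b n" x] ab(1) I(2)[OF that]
    unfolding is_interval_1 by (meson atLeastAtMost_iff)
  have restr: "density N (indicator (B n)) = density N' (indicator (B n))" for n
  proof (rule split_measure_eqI)
    let ?C = "C \<union> C'"
    show "countable ?C" using C C' by simp
    have "left_parts_in d ?C N" "left_parts_in d ?C N'"
      using C C' by (auto elim: left_parts_in_mono)
    then show "left_parts_in d ?C (density N (indicator (B n)))" "left_parts_in d ?C (density N' (indicator (B n)))"
      using B_sets sN sN' by (simp_all add: left_parts_in_restricted)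
    fix x y :: "nat \<Rightarrow> real" assume xy: "\<And>j. x j \<le> y j"
    have *: "emeasure (density M (indicator (B n))) (gapbox d x y) = emeasure M (gapbox d (clp (a n) (b n) x) (clp (a n) (b n) y))"
      if "sets M = sets (split_space d)" for M
    proof -
      have "emeasure (density M (indicator (B n))) (gapbox d x y) = emeasure M (gapbox d x y \<inter> B n)"
        using that by (subst emeasure_restricted) (auto simp: Int_commute)
      then show ?thesis
        unfolding B_def using gapbox_Int_clp[of x y "a n" "b n" d] xy ab(1) by simp
    qed
    have **: "emeasure N (gapbox d (clp (a n) (b n) x) (clp (a n) (b n) y)) =
        emeasure N' (gapbox d (clp (a n) (b n) x) (clp (a n) (b n) y)) \<and>
        emeasure N (gapbox d (clp (a n) (b n) x) (clp (a n) (b n) y)) \<noteq> \<infinity>"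
      using clp_I xy by (intro eq conjI clp_mono) auto
    show "emeasure (density N (indicator (B n))) (gapbox d x y) = emeasure (density N' (indicator (B n))) (gapbox d x y)"
      "emeasure (density N (indicator (B n))) (gapbox d x y) \<noteq> \<infinity>"
      unfolding *[OF sN] *[OF sN'] using ** by blast+
  qed (use sN sN' in auto)
  have B_mono: "incseq B"
    unfolding B_def using ab(2) by (intro monoI gapbox_mono) auto
  have lim: "emeasure M A = (SUP n. emeasure (density M (indicator (B n))) A)"
    if M: "carried_by d I M" and A: "A \<in> sets (split_space d)" for M A
  proof -
    have sM: "sets M = sets (split_space d)" using M by (simp add: carried_by_def)
    have "emeasure (density M (indicator (B n))) A = emeasure M (A \<inter> B n)" for n
      using sM A by (subst emeasure_restricted) (auto simp: Int_commute)
    then have "(SUP n. emeasure (density M (indicator (B n))) A) = (SUP n. emeasure M (A \<inter> B n))"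
      by simp
    also have "\<dots> = emeasure M (\<Union>n. A \<inter> B n)"
      using sM A B_mono by (intro SUP_emeasure_incseq) (auto simp: monotone_def)
    also have "\<dots> = emeasure M A"
    proof (rule emeasure_eq_AE)
      have "AE z in M. \<forall>j\<in>{1..d}. fst (z j) \<in> I j" using M by (simp add: carried_by_def)
      then show "AE z in M. z \<in> (\<Union>n. A \<inter> B n) \<longleftrightarrow> z \<in> A"
        using AE_space
      proof eventually_elim
        case (elim z)
        then obtain n where n: "\<forall>i\<in>{1..d}. a n i < fst (z i) \<and> fst (z i) < b n i"
          using ab(4)[of "\<lambda>i. fst (z i)"] by auto
        have "z \<in> extensional {1..d}"
          using elim sets_eq_imp_space_eq[OF sM] by (simp add: space_split_space PiE_def)
        then have "z \<in> B n"
          using n less_in_gap by (auto simp: B_def gapbox_def PiE_iff)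
        then show ?case by auto
      qed
    qed (use sM A in auto)
    finally show ?thesis ..
  qed
  show "sets N = sets N'" using sN sN' by simp
  show "emeasure N A = emeasure N' A" if "A \<in> sets N" for A
    using lim[OF N(1), of A] lim[OF N(2), of A] restr that sN by simp
qed

lemma exists_split_measure:
  assumes I: "\<And>i. i \<in> {1..d} \<Longrightarrow> open (I i)" "\<And>i. i \<in> {1..d} \<Longrightarrow> is_interval (I i)"
      "\<And>i. i \<in> {1..d} \<Longrightarrow> I i \<noteq> {}"
    and nonneg: "\<And>x y. (\<And>j. j \<in> {1..d} \<Longrightarrow> x j \<in> I j \<and> y j \<in> I j \<and> x j \<le> y j) \<Longrightarrow> 0 \<le> mdiff d x y f"
  shows "\<exists>N. carried_by d I N \<and> (\<forall>x y. (\<forall>j\<in>{1..d}. x j \<in> I j \<and> y j \<in> I j \<and> x j \<le> y j) \<longrightarrow>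
      emeasure N (gapbox d x y) = ennreal (mdiff d x y f))"
proof -
  obtain a b :: "nat \<Rightarrow> nat \<Rightarrow> real" where ab':
    "\<forall>n i. a n i \<le> b n i" "\<forall>n m i. n \<le> m \<longrightarrow> a m i \<le> a n i \<and> b n i \<le> b m i"
    "\<forall>n. \<forall>i\<in>{1..d}. a n i \<in> I i \<and> b n i \<in> I i"
    "\<forall>x. (\<forall>i\<in>{1..d}. x i \<in> I i) \<longrightarrow> (\<exists>n. \<forall>i\<in>{1..d}. a n i < x i \<and> x i < b n i)"
    by (rule open_box_exhaustion[of d I, OF I(1,3)])
  note ab = ab'[rule_format]
  define B where "B n = gapbox d (a n) (b n)" for n
  have B_sets [measurable]: "B n \<in> sets (split_space d)" for n
    by (simp add: B_def)
  have clp_I: "clp (a n) (b n) x j \<in> I j" if "j \<in> {1..d}" for n x j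
    using ab(3)[OF that, of n] clp_in[of "a n" j "b n" x] ab(1) I(2)[OF that]
    unfolding is_interval_1 by (meson atLeastAtMost_iff)
  define F where "F n v = f (\<lambda>i\<in>{1..d}. max (a n i) (min (b n i) (v i)))" for n v
  have F: "mdiff d x y (F n) = mdiff d (clp (a n) (b n) x) (clp (a n) (b n) y) f" for n x y
    unfolding F_def clp_def by (rule mdiff_comp)
  have clp_clp: "clp (a n) (b n) (clp (a m) (b m) x) = clp (a n) (b n) x"
    "clp (a m) (b m) (clp (a n) (b n) x) = clp (a n) (b n) x" if "n \<le> m" for n m x
    using ab(1)[of n] ab(2)[OF that] unfolding clp_def by (simp_all add: clamp_clamp)
  have "\<exists>N C. sets N = sets (split_space d) \<and> finite_measure N \<and> countable C \<and> left_parts_in d C N \<and>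
    (\<forall>x y. (\<forall>j. x j \<le> y j) \<longrightarrow> emeasure N (gapbox d x y) = ennreal (mdiff d x y (F n)))" for n
  proof (rule exists_finite_split_measure[OF ab(1)])
    show "0 \<le> mdiff d x y (F n)" if "\<And>j. x j \<le> y j" for x y
      unfolding F using that clp_I by (intro nonneg conjI clp_mono) auto
    show "mdiff d x y (F n) = mdiff d (clp (a n) (b n) x) (clp (a n) (b n) y) (F n)" for x y
      unfolding F clp_clp[OF order_refl] ..
  qed
  then obtain \<nu> C where sets_\<nu>: "\<And>n. sets (\<nu> n) = sets (split_space d)"
    and C: "\<And>n. countable (C n)" "\<And>n. left_parts_in d (C n) (\<nu> n)"
    and em_\<nu>: "\<And>n x y. \<forall>j. x j \<le> y j \<Longrightarrow> emeasure (\<nu> n) (gapbox d x y) = ennreal (mdiff d x y (F n))"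
    by metis
  \<comment> \<open>Both sides give a gap box the mixed difference of \<open>f\<close> between its
    corners clamped to box \<open>n\<close>; a further clamp to the larger box \<open>m\<close>
    makes no difference.\<close>
  have restr: "density (\<nu> m) (indicator (B n)) = \<nu> n" if "n \<le> m" for n m
  proof (rule split_measure_eqI)
    let ?C = "C n \<union> C m"
    show "countable ?C" using C by simp
    have "left_parts_in d ?C (\<nu> m)"
      by (rule left_parts_in_mono[OF C(2)]) auto
    then show "left_parts_in d ?C (density (\<nu> m) (indicator (B n)))"
      using B_sets sets_\<nu> by (simp add: left_parts_in_restricted)
    show "left_parts_in d ?C (\<nu> n)"
      by (rule left_parts_in_mono[OF C(2)]) auto
    fix x y :: "nat \<Rightarrow> real" assume xy: "\<And>j. x j \<le> y j"
    have "emeasure (density (\<nu> m) (indicator (B n))) (gapbox d x y) = emeasure (\<nu> m) (gapbox d x y \<inter> B n)"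
      using sets_\<nu> by (subst emeasure_restricted) (auto simp: Int_commute)
    also have "\<dots> = emeasure (\<nu> m) (gapbox d (clp (a n) (b n) x) (clp (a n) (b n) y))"
      unfolding B_def using gapbox_Int_clp[of x y "a n" "b n" d] xy ab(1) by simp
    also have "\<dots> = ennreal (mdiff d x y (F n))"
      using xy by (subst em_\<nu>) (auto simp: F clp_clp[OF that] intro: clp_mono)
    finally have *: "emeasure (density (\<nu> m) (indicator (B n))) (gapbox d x y) = ennreal (mdiff d x y (F n))" .
    then show "emeasure (density (\<nu> m) (indicator (B n))) (gapbox d x y) = emeasure (\<nu> n) (gapbox d x y)"
      using em_\<nu> xy by simp
    show "emeasure (density (\<nu> m) (indicator (B n))) (gapbox d x y) \<noteq> \<infinity>"
      using * by simp
  qed (use sets_\<nu> in auto)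
  have \<nu>_restr: "emeasure (\<nu> n) A = emeasure (\<nu> m) (A \<inter> B n)" if "n \<le> m" "A \<in> sets (split_space d)" for n m A
    unfolding restr[OF that(1), symmetric]
    using sets_\<nu> that by (subst emeasure_restricted) (auto simp: Int_commute)
  have mono_\<nu>: "emeasure (\<nu> n) A \<le> emeasure (\<nu> m) A" if "n \<le> m" "A \<in> sets (split_space d)" for n m A
    unfolding \<nu>_restr[OF that] using that sets_\<nu> by (intro emeasure_mono) auto
  obtain N where N: "sets N = sets (split_space d)"
    and em_N: "\<And>A. A \<in> sets (split_space d) \<Longrightarrow> emeasure N A = (SUP n. emeasure (\<nu> n) A)"
    by (rule measure_of_SUP_measures[of \<nu> "split_space d"]) (use sets_\<nu> mono_\<nu> in \<open>auto simp: incseq_def\<close>)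
  have "carried_by d I N"
    unfolding carried_by_def
  proof (intro conjI exI)
    let ?C = "\<Union>n. C n"
    show cC: "countable ?C" using C by auto
    have "left_parts_in d ?C (\<nu> n)" for n
      by (rule left_parts_in_mono[OF C(2)]) auto
    then have "emeasure N (left_exc d ?C) = 0"
      using em_N[OF left_exc_sets[OF cC]] left_parts_in_iff[OF cC sets_\<nu>] by simp
    then show "left_parts_in d ?C N"
      using left_parts_in_iff[OF cC N] by simp
    define X where "X = {z \<in> space (split_space d). \<not> (\<forall>j\<in>{1..d}. fst (z j) \<in> I j)}"
    have "{z \<in> space (split_space d). \<forall>j\<in>{1..d}. fst (z j) \<in> I j} \<in> sets (split_space d)"
    proof (rule sets.sets_Collect_finite_All, goal_cases)
      case (1 j)
      note borel_open[OF I(1)[OF 1], measurable] 1[measurable]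
      show ?case by measurable
    qed auto
    from sets.Diff[OF sets.top this] have X: "X \<in> sets (split_space d)"
      by (auto simp: X_def intro: back_subst[of "\<lambda>A. A \<in> sets (split_space d)"])
    \<comment> \<open>By \<open>\<nu>_restr\<close> the measure \<open>\<nu> n\<close> lives on
      \<open>B n\<close>, which lies over a closed box with corners in \<open>I\<close>, so it does
      not charge points outside the open box.\<close>
    have "X \<inter> B n = {}" for n
    proof -
      have "z \<notin> X" if "z \<in> B n" for z
        using gapbox_in_intervals[of z d "a n" "b n" _ I] that ab(3) I(2) by (auto simp: X_def B_def)
      then show ?thesis by blast
    qed
    then have "emeasure (\<nu> n) X = 0" for n
      using \<nu>_restr[OF order_refl X, of n] by simp
    then have "emeasure N X = 0"
      using em_N[OF X] by simp
    then show "AE z in N. \<forall>j\<in>{1..d}. fst (z j) \<in> I j"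
      using X N sets_eq_imp_space_eq[OF N] by (subst AE_iff_measurable[of X]) (auto simp: X_def)
  qed (rule N)
  moreover have "emeasure N (gapbox d x y) = ennreal (mdiff d x y f)"
    if xy: "\<And>j. j \<in> {1..d} \<Longrightarrow> x j \<in> I j \<and> y j \<in> I j \<and> x j \<le> y j" for x y
  proof -
    \<comment> \<open>The masses of \<open>\<nu> n\<close> are known for cut points ordered at every
      index, so values outside \<open>{1..d}\<close> are set to \<open>0\<close>.\<close>
    define x' where "x' j = (if j \<in> {1..d} then x j else 0)" for j
    define y' where "y' j = (if j \<in> {1..d} then y j else 0)" for j
    have le: "\<forall>j. x' j \<le> y' j" using xy by (auto simp: x'_def y'_def)
    have box: "gapbox d x y = gapbox d x' y'"
      unfolding gapbox_def by (intro PiE_cong) (auto simp: x'_def y'_def)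
    obtain k where k: "\<forall>i\<in>{1..d}. a k i < x i \<and> x i < b k i"
      using ab(4)[of x] xy by blast
    obtain l where l: "\<forall>i\<in>{1..d}. a l i < y i \<and> y i < b l i"
      using ab(4)[of y] xy by blast
    \<comment> \<open>Once box \<open>n\<close> contains both corners, clamping does not move them,
      so the increasing sequence of masses is eventually constant.\<close>
    have const: "emeasure (\<nu> n) (gapbox d x y) = ennreal (mdiff d x y f)" if "max k l \<le> n" for n
    proof -
      have "x i \<in> {a n i..b n i} \<and> y i \<in> {a n i..b n i}" if "i \<in> {1..d}" for i
        using k l that ab(2)[of k n i] ab(2)[of l n i] \<open>max k l \<le> n\<close> by fastforce
      then have "mdiff d x' y' (F n) = mdiff d x y f"
        unfolding F by (intro mdiff_cong_pts) (auto simp: clp_def x'_def y'_def)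
      then show ?thesis
        unfolding box using em_\<nu>[OF le] by simp
    qed
    have "(SUP n. emeasure (\<nu> n) (gapbox d x y)) = ennreal (mdiff d x y f)"
    proof (rule antisym)
      show "(SUP n. emeasure (\<nu> n) (gapbox d x y)) \<le> ennreal (mdiff d x y f)"
      proof (rule SUP_least)
        fix n
        have "emeasure (\<nu> n) (gapbox d x y) \<le> emeasure (\<nu> (max n (max k l))) (gapbox d x y)"
          by (intro mono_\<nu>) auto
        then show "emeasure (\<nu> n) (gapbox d x y) \<le> ennreal (mdiff d x y f)"
          using const[of "max n (max k l)"] by simp
      qed
      show "ennreal (mdiff d x y f) \<le> (SUP n. emeasure (\<nu> n) (gapbox d x y))"
        using const[of "max k l"] by (intro SUP_upper2[of "max k l"]) auto
    qed
    then show ?thesis using em_N[OF gapbox_sets] by simp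
  qed
  ultimately show ?thesis by blast
qed

section \<open>The integral representation\<close>

lemma AE_sum_measures:
  assumes "sets N = sets S" "\<And>k. k \<in> K \<Longrightarrow> sets (M k) = sets S"
    and "\<And>A. A \<in> sets S \<Longrightarrow> emeasure N A = (\<Sum>k\<in>K. emeasure (M k) A)"
    and P: "{x \<in> space S. P x} \<in> sets S" "\<And>k. k \<in> K \<Longrightarrow> AE x in M k. P x"
  shows "AE x in N. P x"
proof -
  have sp: "space N = space S" "\<And>k. k \<in> K \<Longrightarrow> space (M k) = space S"
    using sets_eq_imp_space_eq assms(1,2) by blast+
  let ?B = "{x \<in> space S. \<not> P x}"
  have "?B = space S - {x \<in> space S. P x}" by auto
  then have B: "?B \<in> sets S" using P(1) by auto
  have "emeasure (M k) ?B = 0" if "k \<in> K" for k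
    using P(2)[OF that] assms(2)[OF that] sp(2)[OF that] B by (subst (asm) AE_iff_measurable[of ?B]) auto
  then have "emeasure N ?B = 0"
    using assms(3)[OF B] by simp
  then show ?thesis
    using assms(1) sp(1) B by (subst AE_iff_measurable[of ?B]) auto
qed

text \<open>As a set of functions on all indices it is a full product, with the one-point factor
  \<open>{undefined}\<close> outside \<open>J\<close>, so Tychonoff's theorem applies.\<close>

lemma compact_PiE_atLeastAtMost:
  fixes x y :: "nat \<Rightarrow> real"
  shows "compact (Pi\<^sub>E J (\<lambda>j. {x j..y j}))"
proof -
  let ?S = "\<lambda>j. if j \<in> J then {x j..y j} else {undefined}"
  have eq: "Pi\<^sub>E J (\<lambda>j. {x j..y j}) = Pi\<^sub>E UNIV ?S"
    by (auto simp: PiE_iff extensional_def split: if_splits)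
  have "compactin (product_topology (\<lambda>_. euclideanreal) UNIV) (Pi\<^sub>E UNIV ?S)"
    unfolding compactin_PiE by auto
  then show ?thesis
    unfolding eq euclidean_product_topology by simp
qed

lemma finite_side_functions:
  fixes d :: nat
  shows "finite ({1..d} \<rightarrow>\<^sub>E (UNIV :: side set))"
  by (intro finite_PiE) (auto simp: UNIV_side)

section \<open>Families of measures and measures on the split power\<close>

locale open_box =
  fixes d :: nat and I :: "nat \<Rightarrow> real set" and \<alpha> :: "nat \<Rightarrow> real"
  assumes open_I: "\<And>i. i \<in> {1..d} \<Longrightarrow> open (I i)"
    and interval_I: "\<And>i. i \<in> {1..d} \<Longrightarrow> is_interval (I i)"
    and base: "\<alpha> \<in> Pi\<^sub>E {1..d} I"
begin

abbreviation cube :: "(nat \<Rightarrow> real) set" where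
  "cube \<equiv> Pi\<^sub>E {1..d} I"

abbreviation box_borel :: "(nat \<Rightarrow> real) measure" where
  "box_borel \<equiv> restrict_space borel cube"

abbreviation side_functions :: "(nat \<Rightarrow> side) set" where
  "side_functions \<equiv> {1..d} \<rightarrow>\<^sub>E UNIV"

text \<open>Over the cube, the split power consists of one copy of the cube for each
  \<open>b\<close>. \<open>tag b\<close> enters that copy, \<open>sides\<close> tells in which copy
  a point lies and \<open>points\<close> gives its position there.\<close>

definition tag :: "(nat \<Rightarrow> side) \<Rightarrow> (nat \<Rightarrow> real) \<Rightarrow> nat \<Rightarrow> real \<times> side" where
  "tag b u = (\<lambda>j\<in>{1..d}. (u j, b j))"

definition sides :: "(nat \<Rightarrow> real \<times> side) \<Rightarrow> nat \<Rightarrow> side" where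
  "sides z = (\<lambda>j\<in>{1..d}. snd (z j))"

definition points :: "(nat \<Rightarrow> real \<times> side) \<Rightarrow> nat \<Rightarrow> real" where
  "points z = (\<lambda>j\<in>{1..d}. fst (z j))"

lemma nonempty_I: "i \<in> {1..d} \<Longrightarrow> I i \<noteq> {}"
  using base by auto

lemma base_in: "i \<in> {1..d} \<Longrightarrow> \<alpha> i \<in> I i"
  using base by auto

lemma space_box_borel: "space box_borel = cube"
  by (simp add: space_restrict_space)

lemma sides_tag: "b \<in> side_functions \<Longrightarrow> sides (tag b u) = b"
  by (auto simp: sides_def tag_def PiE_iff extensional_def fun_eq_iff)

lemma points_tag: "u \<in> cube \<Longrightarrow> points (tag b u) = u"
  by (auto simp: points_def tag_def PiE_iff extensional_def fun_eq_iff)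

lemma tag_points: "z \<in> space (split_space d) \<Longrightarrow> sides z = b \<Longrightarrow> tag b (points z) = z"
  by (rule ext) (auto simp: sides_def points_def tag_def space_split_space PiE_iff extensional_def)

lemma sides_in: "sides z \<in> side_functions"
  by (auto simp: sides_def)

lemma measurable_coord_box: "(\<lambda>u. u j) \<in> borel_measurable box_borel"
  by (intro measurable_restrict_space1 measurable_product_coordinates)

lemma measurable_tag: "tag b \<in> box_borel \<rightarrow>\<^sub>M split_space d"
  unfolding tag_def split_space_def split_borel_def
  by (intro measurable_restrict measurable_Pair measurable_coord_box) auto

lemma measurable_points: "points \<in> split_space d \<rightarrow>\<^sub>M Pi\<^sub>M {1..d} (\<lambda>_. borel)"
  unfolding points_def
  by (intro measurable_restrict measurable_compose[OF measurable_coord_split measurable_fst_split])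

lemma box_sets_PiM: "cube \<in> sets (Pi\<^sub>M {1..d} (\<lambda>_. borel))"
  using open_I by (intro sets_PiM_I_finite) auto

lemma box_borel_sets_PiM: "A \<in> sets box_borel \<Longrightarrow> A \<in> sets (Pi\<^sub>M {1..d} (\<lambda>_. borel))"
  unfolding sets_borel_PiE using box_sets_PiM
  by (subst (asm) sets_restrict_space_iff) auto

lemma sides_sets: "{z \<in> space (split_space d). sides z = b} \<in> sets (split_space d)"
proof (cases "b \<in> side_functions")
  case True
  have "{z \<in> space (split_space d). sides z = b} = {z \<in> space (split_space d). \<forall>j\<in>{1..d}. snd (z j) = b j}"
    using True by (auto simp: sides_def PiE_iff extensional_def fun_eq_iff)
  also have "\<dots> \<in> sets (split_space d)"
  proof (rule sets.sets_Collect_finite_All, goal_cases)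
    case (1 j)
    note 1[measurable]
    show ?case by measurable
  qed auto
  finally show ?thesis .
next
  case False
  then have "{z \<in> space (split_space d). sides z = b} = {}" using sides_in by blast
  then show ?thesis by (simp only: sets.empty_sets)
qed

text \<open>\<open>N\<close> is the sum of the images of \<open>\<mu> b\<close> under
  \<open>tag b\<close>; the countable sets carrying the finitely many discrete marginals are united
  into one.\<close>

lemma split_measure_of_family:
  assumes sets_\<mu>: "\<And>b. b \<in> side_functions \<Longrightarrow> sets (\<mu> b) = sets box_borel"
    and discr: "\<And>b i. b \<in> side_functions \<Longrightarrow> i \<in> {1..d} \<Longrightarrow> b i = L \<Longrightarrow> discrete_measure (marginal i (\<mu> b))"
  obtains N where "carried_by d I N"
    "\<And>A. A \<in> sets (split_space d) \<Longrightarrow> emeasure N A = (\<Sum>b\<in>side_functions. emeasure (\<mu> b) (tag b -` A \<inter> cube))"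
proof -
  have space_\<mu>: "space (\<mu> b) = cube" if "b \<in> side_functions" for b
    using sets_eq_imp_space_eq[OF sets_\<mu>[OF that]] unfolding space_box_borel .
  have meas_\<mu>: "measurable (\<mu> b) M = measurable box_borel M" if "b \<in> side_functions" for b and M :: "'z measure"
    by (rule measurable_cong_sets[OF sets_\<mu>[OF that] refl])
  define M where "M b = distr (\<mu> b) (split_space d) (tag b)" for b
  have tag_\<mu>: "tag b \<in> \<mu> b \<rightarrow>\<^sub>M split_space d" if "b \<in> side_functions" for b
    using meas_\<mu>[OF that] measurable_tag by blast
  obtain N where sets_N: "sets N = sets (split_space d)"
    and em_N: "\<And>A. A \<in> sets (split_space d) \<Longrightarrow> emeasure N A = (\<Sum>b\<in>side_functions. emeasure (M b) A)"
    by (rule measure_of_sum_measures[of side_functions M "split_space d"])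
       (auto simp: M_def finite_side_functions simp del: One_nat_def)
  have "\<forall>b i. \<exists>C. b \<in> side_functions \<and> i \<in> {1..d} \<and> b i = L \<longrightarrow> countable C \<and> (AE u in \<mu> b. u i \<in> C)"
  proof (intro allI)
    fix b i
    show "\<exists>C. b \<in> side_functions \<and> i \<in> {1..d} \<and> b i = L \<longrightarrow> countable C \<and> (AE u in \<mu> b. u i \<in> C)"
    proof (cases "b \<in> side_functions \<and> i \<in> {1..d} \<and> b i = L")
      case True
      then obtain C where C: "countable C" "AE x in marginal i (\<mu> b). x \<in> C"
        using discr unfolding discrete_measure_def by blast
      have "(\<lambda>u. u i) \<in> borel_measurable (\<mu> b)"
        using True meas_\<mu>[of b borel] measurable_coord_box by blast
      from AE_distrD[OF this C(2)[unfolded marginal_def]] C(1) show ?thesis by blast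
    qed blast
  qed
  then obtain C where C: "\<And>b i. b \<in> side_functions \<Longrightarrow> i \<in> {1..d} \<Longrightarrow> b i = L \<Longrightarrow>
      countable (C b i) \<and> (AE u in \<mu> b. u i \<in> C b i)"
    by metis
  define D where "D = (\<Union>b\<in>side_functions. \<Union>i\<in>{i\<in>{1..d}. b i = L}. C b i)"
  have cD: "countable D"
    unfolding D_def
    by (intro countable_UN[OF countable_finite[OF finite_side_functions]] countable_UN[OF countable_finite])
       (use C in auto)
  have left_M: "AE z in M b. \<forall>j\<in>{1..d}. snd (z j) = L \<longrightarrow> fst (z j) \<in> D" if b: "b \<in> side_functions" for b
  proof -
    have "AE u in \<mu> b. b j = L \<longrightarrow> u j \<in> D" if "j \<in> {1..d}" for j
    proof (cases "b j = L")
      case True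
      then have "AE u in \<mu> b. u j \<in> C b j" using C b that by blast
      then show ?thesis
        using b that True by (auto simp: D_def elim!: eventually_mono)
    qed simp
    then have "AE u in \<mu> b. \<forall>j\<in>{1..d}. b j = L \<longrightarrow> u j \<in> D"
      by (intro AE_finite_allI) auto
    then show ?thesis
      unfolding M_def by (subst AE_distr_iff[OF tag_\<mu>[OF b] left_parts_sets[OF cD]]) (auto simp: tag_def elim!: eventually_mono)
  qed
  have I_sets: "{z \<in> space (split_space d). \<forall>j\<in>{1..d}. fst (z j) \<in> I j} \<in> sets (split_space d)"
  proof (rule sets.sets_Collect_finite_All, goal_cases)
    case (1 j)
    note borel_open[OF open_I[OF 1], measurable] 1[measurable]
    show ?case by measurable
  qed auto
  have I_M: "AE z in M b. \<forall>j\<in>{1..d}. fst (z j) \<in> I j" if b: "b \<in> side_functions" for b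
    unfolding M_def
    by (subst AE_distr_iff[OF tag_\<mu>[OF b] I_sets]) (auto simp: space_\<mu>[OF b] tag_def PiE_iff intro!: AE_I2)
  have "carried_by d I N"
    unfolding carried_by_def left_parts_in_def
  proof (intro conjI exI)
    show "AE z in N. \<forall>j\<in>{1..d}. snd (z j) = L \<longrightarrow> fst (z j) \<in> D"
      by (rule AE_sum_measures[OF sets_N _ em_N left_parts_sets[OF cD] left_M]) (auto simp: M_def)
    show "AE z in N. \<forall>j\<in>{1..d}. fst (z j) \<in> I j"
      by (rule AE_sum_measures[OF sets_N _ em_N I_sets I_M]) (auto simp: M_def)
  qed (use sets_N cD in auto)
  moreover have "emeasure N A = (\<Sum>b\<in>side_functions. emeasure (\<mu> b) (tag b -` A \<inter> cube))"
    if A: "A \<in> sets (split_space d)" for A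
    unfolding em_N[OF A] M_def using tag_\<mu> A by (intro sum.cong refl) (simp add: emeasure_distr space_\<mu>)
  ultimately show thesis by (rule that)
qed

text \<open>Images under different tags are disjoint, so cutting \<open>N\<close> down to one side
  pattern recovers that member. Equal split measures therefore come from equal families.\<close>

lemma family_eq_split_measure:
  assumes em_N: "\<And>A. A \<in> sets (split_space d) \<Longrightarrow>
      emeasure N A = (\<Sum>b\<in>side_functions. emeasure (\<mu> b) (tag b -` A \<inter> cube))"
    and b: "b \<in> side_functions" and A: "A \<in> sets box_borel"
  shows "emeasure (\<mu> b) A = emeasure N {z \<in> space (split_space d). sides z = b \<and> points z \<in> A}"
proof -
  let ?Z = "{z \<in> space (split_space d). sides z = b \<and> points z \<in> A}"
  have "?Z = {z \<in> space (split_space d). sides z = b} \<inter> (points -` A \<inter> space (split_space d))"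
    by auto
  then have "?Z \<in> sets (split_space d)"
    using sides_sets measurable_sets[OF measurable_points box_borel_sets_PiM[OF A]] by auto
  then have "emeasure N ?Z = (\<Sum>b'\<in>side_functions. emeasure (\<mu> b') (tag b' -` ?Z \<inter> cube))"
    by (rule em_N)
  also have "\<dots> = (\<Sum>b'\<in>side_functions. if b' = b then emeasure (\<mu> b) A else 0)"
  proof (rule sum.cong[OF refl])
    fix b' assume b': "b' \<in> side_functions"
    have tag: "tag b' u \<in> space (split_space d)" for u
      by (auto simp: tag_def space_split_space)
    have "A \<subseteq> cube" using sets.sets_into_space[OF A] unfolding space_box_borel .
    then have "tag b' -` ?Z \<inter> cube = (if b' = b then A else {})"
      using sides_tag[OF b'] points_tag tag by auto
    then show "emeasure (\<mu> b') (tag b' -` ?Z \<inter> cube) = (if b' = b then emeasure (\<mu> b) A else 0)"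
      by simp
  qed
  also have "\<dots> = emeasure (\<mu> b) A"
    using b finite_side_functions by (simp add: sum.delta)
  finally show ?thesis ..
qed

text \<open>The projections of \<open>K\<close> are compact in open intervals, so corners exist
  strictly beyond them. Strictness matters: a gap omits the right part of its lower end point and
  the left part of its upper one.\<close>

lemma compact_subset_gapbox:
  assumes "compact K" "K \<subseteq> cube"
  obtains x y where "\<forall>j\<in>{1..d}. x j \<in> I j \<and> y j \<in> I j \<and> x j \<le> y j" "\<forall>b. \<forall>u\<in>K. tag b u \<in> gapbox d x y"
proof (cases "K = {}")
  case True
  then show thesis using base_in by (intro that[of \<alpha> \<alpha>]) auto
next
  case False
  have "\<exists>s t. s \<in> I j \<and> t \<in> I j \<and> (\<forall>u\<in>K. s < u j \<and> u j < t)" if j: "j \<in> {1..d}" for j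
  proof -
    have "compact ((\<lambda>u. u j) ` K)"
      by (intro compact_continuous_image assms(1) continuous_on_subset[OF continuous_on_product_coordinates]) auto
    moreover have "(\<lambda>u. u j) ` K \<noteq> {}" using False by simp
    ultimately obtain m M where mM: "m \<in> (\<lambda>u. u j) ` K" "M \<in> (\<lambda>u. u j) ` K" "\<forall>u\<in>K. m \<le> u j \<and> u j \<le> M"
      using compact_attains_inf[of "(\<lambda>u. u j) ` K"] compact_attains_sup[of "(\<lambda>u. u j) ` K"]
      by (metis imageI)
    have "m \<in> I j" "M \<in> I j" using mM(1,2) subsetD[OF assms(2), THEN PiE_mem, OF _ j] by blast+
    obtain e where e: "0 < e" "\<And>v. dist v m < e \<Longrightarrow> v \<in> I j"
      using open_I[OF j] \<open>m \<in> I j\<close> unfolding open_dist by blast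
    obtain e' where e': "0 < e'" "\<And>v. dist v M < e' \<Longrightarrow> v \<in> I j"
      using open_I[OF j] \<open>M \<in> I j\<close> unfolding open_dist by blast
    have "m - e / 2 \<in> I j" "M + e' / 2 \<in> I j"
      using e e' by (auto simp: dist_real_def)
    moreover have "m - e / 2 < u j \<and> u j < M + e' / 2" if "u \<in> K" for u
      using bspec[OF mM(3) that] e(1) e'(1) by linarith
    ultimately show ?thesis by blast
  qed
  then have "\<forall>j. \<exists>p. j \<in> {1..d} \<longrightarrow> fst p \<in> I j \<and> snd p \<in> I j \<and> (\<forall>u\<in>K. fst p < u j \<and> u j < snd p)"
    by (metis fst_conv snd_conv)
  then obtain p where p: "\<And>j. j \<in> {1..d} \<Longrightarrow> fst (p j) \<in> I j \<and> snd (p j) \<in> I j \<and> (\<forall>u\<in>K. fst (p j) < u j \<and> u j < snd (p j))"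
    by metis
  show thesis
  proof (rule that[of "\<lambda>j. fst (p j)" "\<lambda>j. snd (p j)"])
    show "\<forall>j\<in>{1..d}. fst (p j) \<in> I j \<and> snd (p j) \<in> I j \<and> fst (p j) \<le> snd (p j)"
      using p False by (meson ex_in_conv less_imp_le less_trans)
    show "\<forall>b. \<forall>u\<in>K. tag b u \<in> gapbox d (\<lambda>j. fst (p j)) (\<lambda>j. snd (p j))"
      using p by (auto simp: gapbox_def tag_def intro!: less_in_gap)
  qed
qed

text \<open>Inverse to \<open>split_measure_of_family\<close>: \<open>N\<close> is restricted to
  each side pattern and projected to the cube. Finiteness on compact sets follows by enclosing them
  in a gap box.\<close>

lemma family_of_split_measure:
  assumes N: "carried_by d I N"
    and fin: "\<And>x y. (\<And>j. j \<in> {1..d} \<Longrightarrow> x j \<in> I j \<and> y j \<in> I j \<and> x j \<le> y j) \<Longrightarrow>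
        emeasure N (gapbox d x y) < \<infinity>"
  obtains \<mu> where
    "\<forall>b\<in>side_functions. sets (\<mu> b) = sets box_borel"
    "\<forall>b\<in>side_functions. \<forall>K. compact K \<and> K \<subseteq> cube \<longrightarrow> emeasure (\<mu> b) K < \<infinity>"
    "\<forall>b\<in>side_functions. \<forall>i\<in>{1..d}. b i = L \<longrightarrow> discrete_measure (marginal i (\<mu> b))"
    "\<forall>A\<in>sets (split_space d). emeasure N A = (\<Sum>b\<in>side_functions. emeasure (\<mu> b) (tag b -` A \<inter> cube))"
proof -
  have sets_N: "sets N = sets (split_space d)" using N by (simp add: carried_by_def)
  have space_N: "space N = space (split_space d)" using sets_eq_imp_space_eq[OF sets_N] .
  obtain C where C: "countable C" "AE z in N. \<forall>j\<in>{1..d}. snd (z j) = L \<longrightarrow> fst (z j) \<in> C"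
    using N unfolding carried_by_def left_parts_in_def by blast
  have AE_I: "AE z in N. points z \<in> cube"
    using N unfolding carried_by_def by (auto simp: points_def elim!: eventually_mono)
  define S where "S b = {z \<in> space (split_space d). sides z = b}" for b
  have S: "S b \<in> sets N" for b
    unfolding S_def sets_N by (rule sides_sets)
  \<comment> \<open>Points outside the cube form a null set; sending them to \<open>\<alpha>\<close>
    gives a measurable map into the cube defined everywhere.\<close>
  define pt where "pt z = (if points z \<in> cube then points z else \<alpha>)" for z
  have pt: "pt \<in> split_space d \<rightarrow>\<^sub>M box_borel"
  proof -
    have "{z \<in> space (split_space d). points z \<in> cube} = points -` cube \<inter> space (split_space d)" by auto
    then have "{z \<in> space (split_space d). points z \<in> cube} \<in> sets (split_space d)"
      using measurable_sets[OF measurable_points box_sets_PiM] by simp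
    moreover have "(\<lambda>_. \<alpha>) \<in> split_space d \<rightarrow>\<^sub>M Pi\<^sub>M {1..d} (\<lambda>_. borel)"
      using base by (intro measurable_const) (auto simp: space_PiM PiE_iff)
    ultimately have "pt \<in> split_space d \<rightarrow>\<^sub>M Pi\<^sub>M {1..d} (\<lambda>_. borel)"
      unfolding pt_def using measurable_points by (intro measurable_If) auto
    then have "pt \<in> split_space d \<rightarrow>\<^sub>M restrict_space (Pi\<^sub>M {1..d} (\<lambda>_. borel)) cube"
      using base by (intro measurable_restrict_space2) (auto simp: pt_def)
    then show ?thesis
      using measurable_cong_sets[OF refl sets_borel_PiE[of "{1..d}" I]] by blast
  qed
  define \<mu> where "\<mu> b = distr (density N (indicator (S b))) box_borel pt" for b
  have pt_d: "pt \<in> density N (indicator (S b)) \<rightarrow>\<^sub>M box_borel" for b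
    using pt sets_N by (simp add: measurable_cong_sets[OF sets_N refl])
  have em_\<mu>: "emeasure (\<mu> b) A = emeasure N (S b \<inter> (pt -` A \<inter> space N))" if "A \<in> sets box_borel" for A b
    unfolding \<mu>_def
    using that pt_d S measurable_sets[OF pt that] sets_N space_N
    by (simp add: emeasure_distr emeasure_restricted)
  have em_tag: "emeasure (\<mu> b) (tag b -` A \<inter> cube) = emeasure N (S b \<inter> A)"
    if "b \<in> side_functions" "A \<in> sets (split_space d)" for b A
  proof -
    have TA: "tag b -` A \<inter> cube \<in> sets box_borel"
      using measurable_sets[OF measurable_tag that(2), of b] unfolding space_box_borel .
    show ?thesis
      unfolding em_\<mu>[OF TA]
    proof (rule emeasure_eq_AE)
      show "AE z in N. z \<in> S b \<inter> (pt -` (tag b -` A \<inter> cube) \<inter> space N) \<longleftrightarrow> z \<in> S b \<inter> A"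
        using AE_I AE_space
      proof eventually_elim
        case (elim z)
        then show ?case
          using tag_points[of z b] by (auto simp: pt_def S_def space_N)
      qed
      show "S b \<inter> (pt -` (tag b -` A \<inter> cube) \<inter> space N) \<in> sets N"
        using S measurable_sets[OF pt TA] sets_N space_N by auto
      show "S b \<inter> A \<in> sets N" using S that sets_N by auto
    qed
  qed
  have "\<forall>A\<in>sets (split_space d). emeasure N A = (\<Sum>b\<in>side_functions. emeasure (\<mu> b) (tag b -` A \<inter> cube))"
  proof
    fix A assume A: "A \<in> sets (split_space d)"
    have "A \<subseteq> space (split_space d)" using sets.sets_into_space[OF A] .
    then have "A = (\<Union>b\<in>side_functions. S b \<inter> A)"
      using sides_in by (auto simp: S_def)
    then have "emeasure N A = emeasure N (\<Union>b\<in>side_functions. S b \<inter> A)" by simp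
    also have "\<dots> = (\<Sum>b\<in>side_functions. emeasure N (S b \<inter> A))"
      using S A sets_N finite_side_functions
      by (intro sum_emeasure[symmetric]) (auto simp: disjoint_family_on_def S_def)
    finally show "emeasure N A = (\<Sum>b\<in>side_functions. emeasure (\<mu> b) (tag b -` A \<inter> cube))"
      using em_tag A by simp
  qed
  moreover have "emeasure (\<mu> b) K < \<infinity>" if b: "b \<in> side_functions" and K: "compact K" "K \<subseteq> cube" for b K
  proof -
    obtain x y where xy: "\<forall>j\<in>{1..d}. x j \<in> I j \<and> y j \<in> I j \<and> x j \<le> y j" "\<forall>b. \<forall>u\<in>K. tag b u \<in> gapbox d x y"
      using compact_subset_gapbox[OF K] by blast
    have T: "tag b -` gapbox d x y \<inter> cube \<in> sets box_borel"
      using measurable_sets[OF measurable_tag gapbox_sets, of b] unfolding space_box_borel .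
    then have "emeasure (\<mu> b) K \<le> emeasure (\<mu> b) (tag b -` gapbox d x y \<inter> cube)"
      using xy(2) K by (intro emeasure_mono) (auto simp: \<mu>_def)
    also have "\<dots> = emeasure N (S b \<inter> gapbox d x y)"
      using b by (intro em_tag) auto
    also have "\<dots> \<le> emeasure N (gapbox d x y)"
      using sets_N by (intro emeasure_mono) auto
    also have "\<dots> < \<infinity>" using fin xy(1) by blast
    finally show ?thesis .
  qed
  moreover have "discrete_measure (marginal i (\<mu> b))" if b: "b \<in> side_functions" and i: "i \<in> {1..d}" "b i = L" for b i
    unfolding discrete_measure_def
  proof (intro exI conjI)
    note countable_borel[OF C(1), measurable]
    have "AE z in N. z \<in> S b \<longrightarrow> pt z i \<in> C"
      using C(2) AE_I
    proof eventually_elim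
      case (elim z)
      show ?case
      proof
        assume "z \<in> S b"
        then have "snd (z i) = b i" using i by (auto simp: S_def sides_def)
        with elim i show "pt z i \<in> C" by (auto simp: pt_def points_def)
      qed
    qed
    then have "AE z in density N (indicator (S b)). pt z i \<in> C"
      using S[of b] by (subst AE_density) (auto simp: indicator_def elim!: eventually_mono)
    then have "AE u in \<mu> b. u i \<in> C"
      unfolding \<mu>_def
      using measurable_sets[OF measurable_coord_box countable_borel[OF C(1)], of i]
      by (subst AE_distr_iff[OF pt_d]) (auto simp: vimage_def Int_def conj_commute)
    moreover have "(\<lambda>u. u i) \<in> borel_measurable (\<mu> b)"
      unfolding \<mu>_def using measurable_coord_box by simp
    ultimately show "AE x in marginal i (\<mu> b). x \<in> C"
      unfolding marginal_def by (subst AE_distr_iff) auto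
  qed (rule C(1))
  moreover have "sets (\<mu> b) = sets box_borel" for b by (simp add: \<mu>_def)
  ultimately show thesis by (intro that[of \<mu>]) auto
qed

section \<open>Mixed differences of the integral terms\<close>

definition chi_integral :: "(nat \<Rightarrow> side) \<Rightarrow> (nat \<Rightarrow> real) measure \<Rightarrow> (nat \<Rightarrow> real) \<Rightarrow> real" where
  "chi_integral b M v = (\<integral>u. (\<Prod>j=1..d. chi (b j) (\<alpha> j) (v j) (u j)) \<partial>M)"

lemma chi_measurable: "chi s x y \<in> borel_measurable borel"
proof -
  have "chi L x y = (\<lambda>u. indicator {..<y} u - indicator {..<x} u)"
    "chi R x y = (\<lambda>u. indicator {..y} u - indicator {..x} u)"
    by (simp_all add: fun_eq_iff)
  then show ?thesis by (cases s) simp_all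
qed

lemma prod_chi_eq_indicator:
  assumes "\<And>j. j \<in> {1..d} \<Longrightarrow> x j \<le> y j"
  shows "(\<Prod>j=1..d. chi (b j) (x j) (y j) (u j)) = indicator (tag b -` gapbox d x y) u"
proof (cases "tag b u \<in> gapbox d x y")
  case True
  then have "chi (b j) (x j) (y j) (u j) = 1" if "j \<in> {1..d}" for j
    using that assms[OF that] by (auto simp: gapbox_def tag_def chi_eq_gap PiE_iff)
  with True show ?thesis by simp
next
  case False
  then obtain j where "j \<in> {1..d}" "(u j, b j) \<notin> gap (x j) (y j)"
    by (auto simp: gapbox_def tag_def PiE_iff)
  then have "\<exists>j\<in>{1..d}. chi (b j) (x j) (y j) (u j) = 0"
    using assms chi_eq_gap by (metis indicator_simps(2))
  then have "(\<Prod>j=1..d. chi (b j) (x j) (y j) (u j)) = 0"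
    by (intro prod_zero) auto
  with False show ?thesis by simp
qed

context
  fixes b :: "nat \<Rightarrow> side" and M :: "(nat \<Rightarrow> real) measure"
  assumes sets_M: "sets M = sets box_borel"
    and fin_M: "\<And>K. compact K \<Longrightarrow> K \<subseteq> cube \<Longrightarrow> emeasure M K < \<infinity>"
begin

lemma space_family: "space M = cube"
  using sets_eq_imp_space_eq[OF sets_M] unfolding space_box_borel .

lemma coord_measurable_family: "(\<lambda>u. u j) \<in> borel_measurable M"
  using measurable_coord_box measurable_cong_sets[OF sets_M refl] by blast

lemma emeasure_cbox_finite:
  assumes "\<And>j. j \<in> {1..d} \<Longrightarrow> x j \<in> I j \<and> y j \<in> I j"
  shows "emeasure M (Pi\<^sub>E {1..d} (\<lambda>j. {x j..y j})) < \<infinity>" "Pi\<^sub>E {1..d} (\<lambda>j. {x j..y j}) \<in> sets M"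
proof -
  have "{x j..y j} \<subseteq> I j" if "j \<in> {1..d}" for j
    using assms[OF that] interval_I[OF that] unfolding is_interval_1 by (meson atLeastAtMost_iff subsetI)
  then have sub: "Pi\<^sub>E {1..d} (\<lambda>j. {x j..y j}) \<subseteq> cube" by (intro PiE_mono)
  then show "emeasure M (Pi\<^sub>E {1..d} (\<lambda>j. {x j..y j})) < \<infinity>"
    by (intro fin_M compact_PiE_atLeastAtMost)
  have "Pi\<^sub>E {1..d} (\<lambda>j. {x j..y j}) \<in> sets (Pi\<^sub>M {1..d} (\<lambda>_. borel))"
    by (intro sets_PiM_I_finite) auto
  then show "Pi\<^sub>E {1..d} (\<lambda>j. {x j..y j}) \<in> sets M"
    unfolding sets_M sets_borel_PiE using sub box_sets_PiM by (subst sets_restrict_space_iff) auto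
qed

text \<open>The integrand is bounded by one and vanishes outside the compact box spanned by
  \<open>\<alpha>\<close> and \<open>v\<close>, which has finite measure.\<close>

lemma integrable_prod_chi:
  assumes "v \<in> cube"
  shows "integrable M (\<lambda>u. \<Prod>j=1..d. chi (b j) (\<alpha> j) (v j) (u j))"
proof (rule integrableI_bounded_set)
  let ?A = "Pi\<^sub>E {1..d} (\<lambda>j. {min (\<alpha> j) (v j)..max (\<alpha> j) (v j)})"
  have "min (\<alpha> j) (v j) \<in> I j \<and> max (\<alpha> j) (v j) \<in> I j" if "j \<in> {1..d}" for j
    using assms base_in[OF that] that by (auto simp: min_def max_def)
  note mM = this
  show "?A \<in> sets M"
    by (rule emeasure_cbox_finite(2)) (rule mM)
  show "emeasure M ?A < \<infinity>"
    by (rule emeasure_cbox_finite(1)) (rule mM)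
  show "(\<lambda>u. \<Prod>j=1..d. chi (b j) (\<alpha> j) (v j) (u j)) \<in> borel_measurable M"
    by (intro borel_measurable_prod measurable_compose[OF coord_measurable_family chi_measurable])
  have bound: "\<bar>chi s p q t\<bar> \<le> 1" for s p q t
    by (cases s) (auto simp: indicator_def)
  then show "AE u\<in>?A in M. norm (\<Prod>j=1..d. chi (b j) (\<alpha> j) (v j) (u j)) \<le> 1"
    by (auto simp: abs_prod intro!: AE_I2 prod_le_1)
  have zero: "chi s p q t = 0" if "t \<notin> {min p q..max p q}" for s p q t
    using that by (cases s) (auto simp: indicator_def)
  show "AE u in M. u \<notin> ?A \<longrightarrow> (\<Prod>j=1..d. chi (b j) (\<alpha> j) (v j) (u j)) = 0"
  proof (rule AE_I2, rule impI)
    fix u assume "u \<in> space M" "u \<notin> ?A"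
    then obtain j where j: "j \<in> {1..d}" "u j \<notin> {min (\<alpha> j) (v j)..max (\<alpha> j) (v j)}"
      unfolding space_family by (auto simp: PiE_iff)
    then show "(\<Prod>j=1..d. chi (b j) (\<alpha> j) (v j) (u j)) = 0"
      using zero[OF j(2)] j(1) by (intro prod_zero bexI[of _ j]) auto
  qed
qed

text \<open>Under the integral the mixed difference factors, and in each factor the base point
  cancels, leaving \<open>chi\<close> from \<open>x j\<close> to \<open>y j\<close>. For ordered cut
  points the product is the indicator of the tagged gap box.\<close>

lemma mdiff_chi_integral:
  assumes xy: "\<And>j. j \<in> {1..d} \<Longrightarrow> x j \<in> I j \<and> y j \<in> I j \<and> x j \<le> y j"
  shows "mdiff d x y (chi_integral b M) = measure M (tag b -` gapbox d x y \<inter> cube)"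
    and "emeasure M (tag b -` gapbox d x y \<inter> cube) = ennreal (measure M (tag b -` gapbox d x y \<inter> cube))"
proof -
  have T: "tag b -` gapbox d x y \<inter> cube \<in> sets M"
    unfolding sets_M using measurable_sets[OF measurable_tag gapbox_sets, of b] unfolding space_box_borel .
  have "mdiff d x y (chi_integral b M) = (\<integral>u. mdiff d x y (\<lambda>v. \<Prod>j=1..d. chi (b j) (\<alpha> j) (v j) (u j)) \<partial>M)"
    unfolding chi_integral_def[abs_def] using xy integrable_prod_chi by (intro mdiff_integral[where I = I]) auto
  also have "\<dots> = (\<integral>u. indicator (tag b -` gapbox d x y) u \<partial>M)"
  proof (intro Bochner_Integration.integral_cong refl)
    fix u
    have "mdiff d x y (\<lambda>v. \<Prod>j=1..d. chi (b j) (\<alpha> j) (v j) (u j)) =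
        (\<Prod>j=1..d. chi (b j) (\<alpha> j) (y j) (u j) - chi (b j) (\<alpha> j) (x j) (u j))"
      by (rule mdiff_prod[of d x y "\<lambda>j t. chi (b j) (\<alpha> j) t (u j)"])
    also have "\<dots> = (\<Prod>j=1..d. chi (b j) (x j) (y j) (u j))"
      by (intro prod.cong refl) (simp add: chi_eq_below)
    also have "\<dots> = indicator (tag b -` gapbox d x y) u"
      using xy by (intro prod_chi_eq_indicator) auto
    finally show "mdiff d x y (\<lambda>v. \<Prod>j=1..d. chi (b j) (\<alpha> j) (v j) (u j)) = indicator (tag b -` gapbox d x y) u" .
  qed
  also have "\<dots> = (\<integral>u. indicator (tag b -` gapbox d x y \<inter> cube) u \<partial>M)"
    by (intro Bochner_Integration.integral_cong refl) (auto simp: space_family indicator_def)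
  also have "\<dots> = measure M (tag b -` gapbox d x y \<inter> cube)"
    using sets.sets_into_space[OF T] by (simp add: Int_absorb2)
  finally show "mdiff d x y (chi_integral b M) = measure M (tag b -` gapbox d x y \<inter> cube)" .
  have "tag b -` gapbox d x y \<inter> cube \<subseteq> Pi\<^sub>E {1..d} (\<lambda>j. {x j..y j})"
  proof
    fix u assume u: "u \<in> tag b -` gapbox d x y \<inter> cube"
    have "u j \<in> {x j..y j}" if "j \<in> {1..d}" for j
    proof -
      have "(u j, b j) \<in> gap (x j) (y j)"
        using u that by (auto simp: gapbox_def tag_def PiE_iff)
      from gap_subset[OF this] show ?thesis by simp
    qed
    with u show "u \<in> Pi\<^sub>E {1..d} (\<lambda>j. {x j..y j})" by (auto simp: PiE_iff)
  qed
  then have "emeasure M (tag b -` gapbox d x y \<inter> cube) \<le> emeasure M (Pi\<^sub>E {1..d} (\<lambda>j. {x j..y j}))"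
    using xy by (intro emeasure_mono emeasure_cbox_finite) auto
  also have "\<dots> < \<infinity>" using xy by (intro emeasure_cbox_finite) auto
  finally show "emeasure M (tag b -` gapbox d x y \<inter> cube) = ennreal (measure M (tag b -` gapbox d x y \<inter> cube))"
    by (intro emeasure_eq_ennreal_measure) auto
qed

end

lemma integral_representation_iff:
  "integral_representation d I \<alpha> f W \<mu> \<longleftrightarrow>
     pseudo_polynomial0 d I W \<and>
     (\<forall>b\<in>side_functions. sets (\<mu> b) = sets box_borel) \<and>
     (\<forall>v\<in>cube. f v = W v + (\<Sum>b\<in>side_functions. chi_integral b (\<mu> b) v)) \<and>
     (\<forall>b\<in>side_functions. \<forall>K. compact K \<and> K \<subseteq> cube \<longrightarrow> emeasure (\<mu> b) K < \<infinity>) \<and>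
     (\<forall>b\<in>side_functions. \<forall>i\<in>{1..d}. b i = L \<longrightarrow> discrete_measure (marginal i (\<mu> b)))"
  unfolding integral_representation_def chi_integral_def ..

lemma mdiff_sum_chi_integral:
  assumes "\<forall>b\<in>side_functions. sets (\<mu> b) = sets box_borel"
    and "\<forall>b\<in>side_functions. \<forall>K. compact K \<and> K \<subseteq> cube \<longrightarrow> emeasure (\<mu> b) K < \<infinity>"
    and xy: "\<And>j. j \<in> {1..d} \<Longrightarrow> x j \<in> I j \<and> y j \<in> I j \<and> x j \<le> y j"
  shows "mdiff d x y (\<lambda>v. \<Sum>b\<in>side_functions. chi_integral b (\<mu> b) v) =
      (\<Sum>b\<in>side_functions. measure (\<mu> b) (tag b -` gapbox d x y \<inter> cube))"
    and "(\<Sum>b\<in>side_functions. emeasure (\<mu> b) (tag b -` gapbox d x y \<inter> cube)) =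
      ennreal (\<Sum>b\<in>side_functions. measure (\<mu> b) (tag b -` gapbox d x y \<inter> cube))"
proof -
  note 1 = mdiff_chi_integral[of "\<mu> b" x y b for b]
  show "mdiff d x y (\<lambda>v. \<Sum>b\<in>side_functions. chi_integral b (\<mu> b) v) =
      (\<Sum>b\<in>side_functions. measure (\<mu> b) (tag b -` gapbox d x y \<inter> cube))"
    unfolding mdiff_sum using assms by (intro sum.cong refl 1(1)) auto
  have "(\<Sum>b\<in>side_functions. emeasure (\<mu> b) (tag b -` gapbox d x y \<inter> cube)) =
      (\<Sum>b\<in>side_functions. ennreal (measure (\<mu> b) (tag b -` gapbox d x y \<inter> cube)))"
    using assms by (intro sum.cong refl 1(2)) auto
  then show "(\<Sum>b\<in>side_functions. emeasure (\<mu> b) (tag b -` gapbox d x y \<inter> cube)) =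
      ennreal (\<Sum>b\<in>side_functions. measure (\<mu> b) (tag b -` gapbox d x y \<inter> cube))"
    by (simp add: sum_ennreal)
qed

section \<open>Equivalence and uniqueness\<close>

lemma mdiff_representation:
  assumes rep: "integral_representation d I \<alpha> f W \<mu>"
    and xy: "\<And>j. j \<in> {1..d} \<Longrightarrow> x j \<in> I j \<and> y j \<in> I j \<and> x j \<le> y j"
  shows "mdiff d x y f = (\<Sum>b\<in>side_functions. measure (\<mu> b) (tag b -` gapbox d x y \<inter> cube))"
proof -
  note rep' = rep[unfolded integral_representation_iff]
  have "mdiff d x y f = mdiff d x y (\<lambda>v. W v + (\<Sum>b\<in>side_functions. chi_integral b (\<mu> b) v))"
    using xy rep' by (intro mdiff_cong[where I = I]) auto
  also have "\<dots> = mdiff d x y W + mdiff d x y (\<lambda>v. \<Sum>b\<in>side_functions. chi_integral b (\<mu> b) v)"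
    by (rule mdiff_add)
  also have "mdiff d x y W = 0"
    using rep' xy by (intro pseudo_polynomial0_mdiff_eq_0) auto
  also have "mdiff d x y (\<lambda>v. \<Sum>b\<in>side_functions. chi_integral b (\<mu> b) v) =
      (\<Sum>b\<in>side_functions. measure (\<mu> b) (tag b -` gapbox d x y \<inter> cube))"
    using rep' xy by (intro mdiff_sum_chi_integral) auto
  finally show ?thesis by simp
qed

lemma box_monotone_of_representation:
  assumes "integral_representation d I \<alpha> f W \<mu>"
  shows "box_monotone d I f"
  unfolding box_monotone_iff_mdiff
  using mdiff_representation[OF assms] by (auto intro!: sum_nonneg)

lemma representation_exists:
  assumes "box_monotone d I f"
  shows "\<exists>W \<mu>. integral_representation d I \<alpha> f W \<mu>"
proof -
  have nonneg: "0 \<le> mdiff d x y f" if "\<And>j. j \<in> {1..d} \<Longrightarrow> x j \<in> I j \<and> y j \<in> I j \<and> x j \<le> y j" for x y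
    using assms that unfolding box_monotone_iff_mdiff by blast
  have "\<exists>N. carried_by d I N \<and> (\<forall>x y. (\<forall>j\<in>{1..d}. x j \<in> I j \<and> y j \<in> I j \<and> x j \<le> y j) \<longrightarrow>
      emeasure N (gapbox d x y) = ennreal (mdiff d x y f))"
    by (rule exists_split_measure) (fact open_I interval_I nonempty_I nonneg)+
  then obtain N where N: "carried_by d I N"
    and em_N: "\<And>x y. (\<forall>j\<in>{1..d}. x j \<in> I j \<and> y j \<in> I j \<and> x j \<le> y j) \<Longrightarrow>
      emeasure N (gapbox d x y) = ennreal (mdiff d x y f)"
    by blast
  obtain \<mu> where \<mu>: "\<forall>b\<in>side_functions. sets (\<mu> b) = sets box_borel"
    "\<forall>b\<in>side_functions. \<forall>K. compact K \<and> K \<subseteq> cube \<longrightarrow> emeasure (\<mu> b) K < \<infinity>"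
    "\<forall>b\<in>side_functions. \<forall>i\<in>{1..d}. b i = L \<longrightarrow> discrete_measure (marginal i (\<mu> b))"
    and N\<mu>: "\<forall>A\<in>sets (split_space d). emeasure N A = (\<Sum>b\<in>side_functions. emeasure (\<mu> b) (tag b -` A \<inter> cube))"
    by (rule family_of_split_measure[OF N]) (auto simp: em_N)
  \<comment> \<open>The remainder is the only possible choice. It is a pseudo-polynomial because the
    integral terms together have the mixed differences of \<open>f\<close>.\<close>
  define W where "W v = f v - (\<Sum>b\<in>side_functions. chi_integral b (\<mu> b) v)" for v
  have "mdiff d x y W = 0" if xy: "\<forall>j\<in>{1..d}. x j \<in> I j \<and> y j \<in> I j \<and> x j \<le> y j" for x y
  proof -
    have xy': "\<And>j. j \<in> {1..d} \<Longrightarrow> x j \<in> I j \<and> y j \<in> I j \<and> x j \<le> y j" using xy by blast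
    let ?s = "\<Sum>b\<in>side_functions. measure (\<mu> b) (tag b -` gapbox d x y \<inter> cube)"
    have "ennreal (mdiff d x y f) = (\<Sum>b\<in>side_functions. emeasure (\<mu> b) (tag b -` gapbox d x y \<inter> cube))"
      by (rule trans[OF em_N[OF xy, symmetric] bspec[OF N\<mu> gapbox_sets]])
    also have "\<dots> = ennreal ?s"
      by (rule mdiff_sum_chi_integral(2)[OF \<mu>(1,2)]) (rule xy')
    finally have "ennreal (mdiff d x y f) = ennreal ?s" .
    moreover have "0 \<le> mdiff d x y f"
      by (rule nonneg) (rule xy')
    ultimately have f: "mdiff d x y f = ?s"
      by (subst (asm) ennreal_inj) (auto intro: sum_nonneg)
    have "mdiff d x y W = mdiff d x y f - mdiff d x y (\<lambda>v. \<Sum>b\<in>side_functions. chi_integral b (\<mu> b) v)"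
      unfolding W_def by (rule mdiff_diff)
    also have "mdiff d x y (\<lambda>v. \<Sum>b\<in>side_functions. chi_integral b (\<mu> b) v) = ?s"
      by (rule mdiff_sum_chi_integral(1)[OF \<mu>(1,2)]) (rule xy')
    finally show ?thesis using f by simp
  qed
  then have "pseudo_polynomial0 d I W"
    unfolding pseudo_polynomial0_iff_mdiff[OF base] by blast
  then have "integral_representation d I \<alpha> f W \<mu>"
    unfolding integral_representation_iff using \<mu> by (simp add: W_def)
  then show ?thesis by blast
qed

text \<open>Each representation gives a split measure whose gap boxes have the mixed differences of
  \<open>f\<close> as masses, so the two split measures coincide. They return the families, and
  \<open>W\<close> is what the integrals leave of \<open>f\<close>.\<close>

lemma representation_unique:
  assumes rep: "integral_representation d I \<alpha> f W \<mu>" and rep': "integral_representation d I \<alpha> f W' \<mu>'"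
  shows "(\<forall>x\<in>cube. W x = W' x) \<and> (\<forall>b\<in>side_functions. \<mu> b = \<mu>' b)"
proof -
  note r = rep[unfolded integral_representation_iff] and r' = rep'[unfolded integral_representation_iff]
  obtain N where N: "carried_by d I N"
    and em_N: "\<And>A. A \<in> sets (split_space d) \<Longrightarrow> emeasure N A = (\<Sum>b\<in>side_functions. emeasure (\<mu> b) (tag b -` A \<inter> cube))"
    by (rule split_measure_of_family[of \<mu>]) (use r in auto)
  obtain N' where N': "carried_by d I N'"
    and em_N': "\<And>A. A \<in> sets (split_space d) \<Longrightarrow> emeasure N' A = (\<Sum>b\<in>side_functions. emeasure (\<mu>' b) (tag b -` A \<inter> cube))"
    by (rule split_measure_of_family[of \<mu>']) (use r' in auto)
  have "N = N'"
  proof (rule split_measure_eqI_on[OF open_I interval_I nonempty_I N N'])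
    fix x y assume xy: "\<And>j. j \<in> {1..d} \<Longrightarrow> x j \<in> I j \<and> y j \<in> I j \<and> x j \<le> y j"
    have "emeasure N (gapbox d x y) = ennreal (\<Sum>b\<in>side_functions. measure (\<mu> b) (tag b -` gapbox d x y \<inter> cube))"
      unfolding em_N[OF gapbox_sets] by (rule mdiff_sum_chi_integral(2)) (use r xy in auto)
    moreover have "emeasure N' (gapbox d x y) = ennreal (\<Sum>b\<in>side_functions. measure (\<mu>' b) (tag b -` gapbox d x y \<inter> cube))"
      unfolding em_N'[OF gapbox_sets] by (rule mdiff_sum_chi_integral(2)) (use r' xy in auto)
    moreover have "mdiff d x y f = (\<Sum>b\<in>side_functions. measure (\<mu> b) (tag b -` gapbox d x y \<inter> cube))"
      by (rule mdiff_representation[OF rep]) (rule xy)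
    moreover have "mdiff d x y f = (\<Sum>b\<in>side_functions. measure (\<mu>' b) (tag b -` gapbox d x y \<inter> cube))"
      by (rule mdiff_representation[OF rep']) (rule xy)
    ultimately show "emeasure N (gapbox d x y) = emeasure N' (gapbox d x y) \<and> emeasure N (gapbox d x y) \<noteq> \<infinity>"
      by simp
  qed
  have \<mu>: "\<mu> b = \<mu>' b" if b: "b \<in> side_functions" for b
  proof (rule measure_eqI)
    show "sets (\<mu> b) = sets (\<mu>' b)" using r r' b by simp
    fix A assume "A \<in> sets (\<mu> b)"
    then have A: "A \<in> sets box_borel" using r b by simp
    have "emeasure (\<mu> b) A = emeasure N {z \<in> space (split_space d). sides z = b \<and> points z \<in> A}"
      by (rule family_eq_split_measure) (fact em_N b A)+
    also have "\<dots> = emeasure (\<mu>' b) A"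
      unfolding \<open>N = N'\<close> by (rule family_eq_split_measure[symmetric]) (fact em_N' b A)+
    finally show "emeasure (\<mu> b) A = emeasure (\<mu>' b) A" .
  qed
  have "W x = W' x" if "x \<in> cube" for x
  proof -
    have "\<forall>v\<in>cube. f v = W v + (\<Sum>b\<in>side_functions. chi_integral b (\<mu> b) v)"
      using r by (elim conjE)
    moreover have "\<forall>v\<in>cube. f v = W' v + (\<Sum>b\<in>side_functions. chi_integral b (\<mu>' b) v)"
      using r' by (elim conjE)
    moreover have "(\<Sum>b\<in>side_functions. chi_integral b (\<mu> b) x) = (\<Sum>b\<in>side_functions. chi_integral b (\<mu>' b) x)"
      by (intro sum.cong refl) (simp only: \<mu>)
    ultimately show ?thesis using that by (metis add_right_cancel)
  qed
  with \<mu> show ?thesis by blast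
qed

end

theorem theorem30:
  fixes d :: nat and I :: "nat \<Rightarrow> real set" and f :: "(nat \<Rightarrow> real) \<Rightarrow> real" and \<alpha> :: "nat \<Rightarrow> real"
  assumes "d \<ge> 1"
    and "\<And>i. i \<in> {1..d} \<Longrightarrow> open (I i) \<and> is_interval (I i)"
    and "\<alpha> \<in> Pi\<^sub>E {1..d} I"
  shows "(box_monotone d I f \<longleftrightarrow> (\<exists>W \<mu>. integral_representation d I \<alpha> f W \<mu>)) \<and>
         (box_monotone d I f \<longrightarrow>
            (\<forall>W W' \<mu> \<mu>'. integral_representation d I \<alpha> f W \<mu> \<longrightarrow>
                          integral_representation d I \<alpha> f W' \<mu>' \<longrightarrow>
                          (\<forall>x\<in>Pi\<^sub>E {1..d} I. W x = W' x) \<and>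
                          (\<forall>b\<in>{1..d} \<rightarrow>\<^sub>E UNIV. \<mu> b = \<mu>' b)))"
proof -
  interpret open_box d I \<alpha>
    using assms by unfold_locales auto
  show ?thesis
    using representation_exists box_monotone_of_representation representation_unique by blast
qed

end
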